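(* Let $N\in\mathbb{N}$. (a) Suppose that for each $1\le i\le N$ we have a bounded linear operator $T_i:H_i\to H_i$ on a complex Hilbert space $H_i$. Then, for the direct sum operator $T=T_1\oplus\cdots\oplus T_N:H\to H$ on the direct sum Hilbert space $H=H_1\oplus\cdots\oplus H_N$, we have $$\overline{\operatorname{span}(\mathcal{E}(T))}=\prod_{i=1}^N\overline{\operatorname{RRec}^{bo}(T_i)}.$$ In particular, the following statements are equivalent: (i) the set $\operatorname{span}(\mathcal{E}(T))$ is dense in $H$; (ii) the set $\operatorname{RRec}^{bo}(T_i)$ is dense in $H_i$ for every $1\le i\le N$. (b) Suppose that for each $1\le i\le N$ we have a power-bounded operator $T_i:X_i\to X_i$ on a complex reflexive Banach space $X_i$. Then, for the direct sum operator $T=T_1\oplus\cdots\oplus T_N:X\to X$ on the direct sum space $X=X_1\oplus\cdots\oplus X_N$, we have $$\overline{\operatorname{span}(\mathcal{E}(T))}=\prod_{i=1}^N\overline{\operatorname{URec}(T_i)}.$$ In particular, the following statements are equivalent: (i) the set $\operatorname{span}(\mathcal{E}(T))$ is dense in $X$; (ii) the set $\operatorname{URec}(T_i)$ is dense in $X_i$ for every $1\le i\le N$.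
   Context: $\mathbb{N}=\{1,2,\dots\}$, $\mathbb{N}_0=\mathbb{N}\cup\{0\}$, $\mathbb{T}=\{z\in\mathbb{C}:|z|=1\}$. For an operator $S$: $\mathcal{E}(S)=\bigcup_{\lambda\in\mathbb{T}}\ker(\lambda-S)\setminus\{0\}$ (with $\operatorname{span}(\varnothing)=\{0\}$); $N(x,A)=\{n\in\mathbb{N}_0:S^nx\in A\}$; $S$ is power-bounded if $\sup_n\|S^n\|<\infty$. The upper Banach density of $A\subset\mathbb{N}_0$ is $\overline{\operatorname{Bd}}(A)=\limsup_{N\to\infty}\left(\max_{m\ge0}\frac{\operatorname{card}(A\cap[m,m+N])}{N+1}\right)$; $A$ is syndetic if there is $m\in\mathbb{N}$ such that $[x,x+m]\cap A\neq\varnothing$ for all $x\in\mathbb{N}_0$. $\operatorname{RRec}^{bo}(S)$ is the set of vectors $x$ with bounded orbit $\{S^nx:n\in\mathbb{N}_0\}$ such that $\overline{\operatorname{Bd}}(N(x,U))>0$ for every norm neighbourhood $U$ of $x$. $\operatorname{URec}(S)$ is the set of vectors $x$ such that $N(x,U)$ is syndetic for every norm neighbourhood $U$ of $x$. Direct sums of Banach spaces carry any norm defining the product topology, and $T(x_1,\dots,x_N)=(T_1x_1,\dots,T_Nx_N)$. Closures are in the norm topologies. *)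

theory Defs
  imports "HOL-Analysis.Analysis" "HOL-Library.Function_Algebras"
begin

text \<open>
  The spaces in the theorem are arbitrary and \<^emph>\<open>different\<close> from each other, and their number is a
  variable, so they cannot be types. A complex normed space is therefore given by a carrier \<open>X\<close>,
  a linear subspace of some complex vector space (the library locale \<^locale>\<open>vector_space\<close>), and a norm
  that is only meaningful on \<open>X\<close>. The surrounding vector space carries no topology, and different
  carriers in it may have unrelated norms. Any family of complex vector spaces embeds as linear
  subspaces into its algebraic direct sum, so that using one surrounding vector space for the whole
  family is no restriction.
\<close>

text \<open>Outside the carrier the distance is set to 0 because \<^locale>\<open>Metric_space\<close> demands a distance that is
  nonnegative and symmetric on the whole type.\<close>

definition nrm_dist :: "'a::ab_group_add set \<Rightarrow> ('a \<Rightarrow> real) \<Rightarrow> 'a \<Rightarrow> 'a \<Rightarrow> real" where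
  "nrm_dist X nrm x y = (if x \<in> X \<and> y \<in> X then nrm (x - y) else 0)"

definition nrm_topology :: "'a::ab_group_add set \<Rightarrow> ('a \<Rightarrow> real) \<Rightarrow> 'a topology" where
  "nrm_topology X nrm = Metric_space.mtopology X (nrm_dist X nrm)"

definition nrm_closure :: "'a::ab_group_add set \<Rightarrow> ('a \<Rightarrow> real) \<Rightarrow> 'a set \<Rightarrow> 'a set" where
  "nrm_closure X nrm A = nrm_topology X nrm closure_of A"

definition nrm_dense :: "'a::ab_group_add set \<Rightarrow> ('a \<Rightarrow> real) \<Rightarrow> 'a set \<Rightarrow> bool" where
  "nrm_dense X nrm A \<longleftrightarrow> nrm_closure X nrm A = X"

definition nrm_nhds :: "'a::ab_group_add set \<Rightarrow> ('a \<Rightarrow> real) \<Rightarrow> 'a \<Rightarrow> 'a set set" where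
  "nrm_nhds X nrm x = {U. U \<subseteq> X \<and> (\<exists>V. openin (nrm_topology X nrm) V \<and> x \<in> V \<and> V \<subseteq> U)}"

locale complex_normed_space = vector_space scl
  for scl :: "complex \<Rightarrow> 'a::ab_group_add \<Rightarrow> 'a" +
  fixes X :: "'a set" and nrm :: "'a \<Rightarrow> real"
  assumes carrier_subspace: "subspace X"
    and nrm_eq_0: "x \<in> X \<Longrightarrow> nrm x = 0 \<longleftrightarrow> x = 0"
    and nrm_scale: "x \<in> X \<Longrightarrow> nrm (scl c x) = cmod c * nrm x"
    and nrm_triangle: "x \<in> X \<Longrightarrow> y \<in> X \<Longrightarrow> nrm (x + y) \<le> nrm x + nrm y"

locale complex_banach_space = complex_normed_space scl X nrm
  for scl :: "complex \<Rightarrow> 'a::ab_group_add \<Rightarrow> 'a" and X nrm +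
  assumes complete: "Metric_space.mcomplete X (nrm_dist X nrm)"

locale complex_hilbert_space = complex_banach_space scl X nrm
  for scl :: "complex \<Rightarrow> 'a::ab_group_add \<Rightarrow> 'a" and X nrm +
  fixes ip :: "'a \<Rightarrow> 'a \<Rightarrow> complex"
  assumes ip_add: "x \<in> X \<Longrightarrow> y \<in> X \<Longrightarrow> z \<in> X \<Longrightarrow> ip (x + y) z = ip x z + ip y z"
    and ip_scale: "x \<in> X \<Longrightarrow> y \<in> X \<Longrightarrow> ip (scl c x) y = c * ip x y"
    and ip_cnj: "x \<in> X \<Longrightarrow> y \<in> X \<Longrightarrow> ip y x = cnj (ip x y)"
    and ip_nrm: "x \<in> X \<Longrightarrow> ip x x = of_real ((nrm x)\<^sup>2)"

definition linear_between ::
  "(complex \<Rightarrow> 'a \<Rightarrow> 'a) \<Rightarrow> 'a set \<Rightarrow> (complex \<Rightarrow> 'b \<Rightarrow> 'b) \<Rightarrow> 'b set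
    \<Rightarrow> ('a::ab_group_add \<Rightarrow> 'b::ab_group_add) \<Rightarrow> bool" where
  "linear_between scl X scl' Y S \<longleftrightarrow> S \<in> X \<rightarrow> Y
     \<and> (\<forall>x\<in>X. \<forall>y\<in>X. S (x + y) = S x + S y) \<and> (\<forall>c. \<forall>x\<in>X. S (scl c x) = scl' c (S x))"

definition bounded_linear_between ::
  "(complex \<Rightarrow> 'a \<Rightarrow> 'a) \<Rightarrow> 'a set \<Rightarrow> ('a \<Rightarrow> real) \<Rightarrow> (complex \<Rightarrow> 'b \<Rightarrow> 'b) \<Rightarrow> 'b set \<Rightarrow> ('b \<Rightarrow> real)
    \<Rightarrow> ('a::ab_group_add \<Rightarrow> 'b::ab_group_add) \<Rightarrow> bool" where
  "bounded_linear_between scl X nrm scl' Y nrm' S \<longleftrightarrow>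
     linear_between scl X scl' Y S \<and> (\<exists>K. \<forall>x\<in>X. nrm' (S x) \<le> K * nrm x)"

abbreviation bounded_operator where
  "bounded_operator scl X nrm S \<equiv> bounded_linear_between scl X nrm scl X nrm S"

text \<open>As in \<^const>\<open>onorm\<close>, the quotient is 0 at \<open>x = 0\<close>.\<close>

definition op_norm :: "'a set \<Rightarrow> ('a \<Rightarrow> real) \<Rightarrow> ('b \<Rightarrow> real) \<Rightarrow> ('a \<Rightarrow> 'b) \<Rightarrow> real" where
  "op_norm X nrm nrm' S = (SUP x\<in>X. nrm' (S x) / nrm x)"

definition power_bounded ::
  "(complex \<Rightarrow> 'a \<Rightarrow> 'a) \<Rightarrow> 'a set \<Rightarrow> ('a \<Rightarrow> real) \<Rightarrow> ('a::ab_group_add \<Rightarrow> 'a) \<Rightarrow> bool" where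
  "power_bounded scl X nrm S \<longleftrightarrow>
     bounded_operator scl X nrm S \<and> bdd_above (range (\<lambda>n. op_norm X nrm nrm (S ^^ n)))"

definition fun_scale :: "(complex \<Rightarrow> 'a \<Rightarrow> 'a) \<Rightarrow> complex \<Rightarrow> ('i \<Rightarrow> 'a) \<Rightarrow> ('i \<Rightarrow> 'a)" where
  "fun_scale scl c f = (\<lambda>i. scl c (f i))"

text \<open>A functional on the carrier is represented by the function that extends it by 0, so that
  distinct elements of the dual are distinct functionals. With the pointwise operations, the dual
  is again a carrier in a complex vector space, and the bidual is the dual of the dual.\<close>

definition dual_space ::
  "(complex \<Rightarrow> 'a \<Rightarrow> 'a) \<Rightarrow> 'a set \<Rightarrow> ('a \<Rightarrow> real) \<Rightarrow> ('a::ab_group_add \<Rightarrow> complex) set" where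
  "dual_space scl X nrm =
     {f. bounded_linear_between scl X nrm (*) UNIV cmod f \<and> (\<forall>x. x \<notin> X \<longrightarrow> f x = 0)}"

definition dual_nrm :: "'a set \<Rightarrow> ('a \<Rightarrow> real) \<Rightarrow> ('a \<Rightarrow> complex) \<Rightarrow> real" where
  "dual_nrm X nrm f = op_norm X nrm cmod f"

definition bidual_space ::
  "(complex \<Rightarrow> 'a \<Rightarrow> 'a) \<Rightarrow> 'a set \<Rightarrow> ('a \<Rightarrow> real) \<Rightarrow> (('a::ab_group_add \<Rightarrow> complex) \<Rightarrow> complex) set" where
  "bidual_space scl X nrm = dual_space (fun_scale (*)) (dual_space scl X nrm) (dual_nrm X nrm)"

definition canonical_embedding ::
  "(complex \<Rightarrow> 'a \<Rightarrow> 'a) \<Rightarrow> 'a set \<Rightarrow> ('a \<Rightarrow> real) \<Rightarrow> 'a::ab_group_add \<Rightarrow> ('a \<Rightarrow> complex) \<Rightarrow> complex" where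
  "canonical_embedding scl X nrm x = (\<lambda>f. if f \<in> dual_space scl X nrm then f x else 0)"

definition reflexive_space ::
  "(complex \<Rightarrow> 'a \<Rightarrow> 'a) \<Rightarrow> 'a set \<Rightarrow> ('a::ab_group_add \<Rightarrow> real) \<Rightarrow> bool" where
  "reflexive_space scl X nrm \<longleftrightarrow>
     canonical_embedding scl X nrm ` X = bidual_space scl X nrm"

definition unimodular_eigenvectors ::
  "(complex \<Rightarrow> 'a \<Rightarrow> 'a) \<Rightarrow> 'a set \<Rightarrow> ('a::ab_group_add \<Rightarrow> 'a) \<Rightarrow> 'a set" where
  "unimodular_eigenvectors scl X S =
     (\<Union>\<mu>\<in>{z. cmod z = 1}. {x \<in> X. scl \<mu> x - S x = 0} - {0})"

definition return_set :: "('a \<Rightarrow> 'a) \<Rightarrow> 'a \<Rightarrow> 'a set \<Rightarrow> nat set" where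
  "return_set S x A = {n. (S ^^ n) x \<in> A}"

text \<open>The maximum is over a finite set of values, since each cardinality is at most \<open>L + 1\<close>.\<close>

definition upper_banach_density :: "nat set \<Rightarrow> ereal" where
  "upper_banach_density A =
     limsup (\<lambda>L. ereal (Max (range (\<lambda>m. real (card (A \<inter> {m..m + L})) / real (L + 1)))))"

definition syndetic :: "nat set \<Rightarrow> bool" where
  "syndetic A \<longleftrightarrow> (\<exists>m\<ge>1. \<forall>x. {x..x + m} \<inter> A \<noteq> {})"

definition RRec_bo :: "'a::ab_group_add set \<Rightarrow> ('a \<Rightarrow> real) \<Rightarrow> ('a \<Rightarrow> 'a) \<Rightarrow> 'a set" where
  "RRec_bo X nrm S = {x \<in> X. (\<exists>K. \<forall>n. nrm ((S ^^ n) x) \<le> K)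
     \<and> (\<forall>U\<in>nrm_nhds X nrm x. upper_banach_density (return_set S x U) > 0)}"

definition URec :: "'a::ab_group_add set \<Rightarrow> ('a \<Rightarrow> real) \<Rightarrow> ('a \<Rightarrow> 'a) \<Rightarrow> 'a set" where
  "URec X nrm S = {x \<in> X. \<forall>U\<in>nrm_nhds X nrm x. syndetic (return_set S x U)}"

text \<open>Tuples indexed by \<open>I\<close> are functions on the whole index type that are 0 outside \<open>I\<close>, so that the
  direct sum is a linear subspace of the vector space of all functions.\<close>

definition tuples :: "'i set \<Rightarrow> ('i \<Rightarrow> 'a set) \<Rightarrow> ('i \<Rightarrow> 'a::zero) set" where
  "tuples I A = {x. (\<forall>i\<in>I. x i \<in> A i) \<and> (\<forall>i. i \<notin> I \<longrightarrow> x i = 0)}"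

definition sum_operator :: "'i set \<Rightarrow> ('i \<Rightarrow> 'a \<Rightarrow> 'a) \<Rightarrow> ('i \<Rightarrow> 'a) \<Rightarrow> ('i \<Rightarrow> 'a::zero)" where
  "sum_operator I T x = (\<lambda>i. if i \<in> I then T i (x i) else 0)"

text \<open>The norms on the direct sum that define the product topology. The library's product topology
  lives on extensional functions, which are \<^const>\<open>undefined\<close> instead of 0 outside \<open>I\<close>; hence the
  identification by \<^const>\<open>restrict\<close>.\<close>

definition direct_sum_norm ::
  "(complex \<Rightarrow> 'a \<Rightarrow> 'a) \<Rightarrow> 'i set \<Rightarrow> ('i \<Rightarrow> 'a set) \<Rightarrow> ('i \<Rightarrow> 'a \<Rightarrow> real)
    \<Rightarrow> (('i \<Rightarrow> 'a::ab_group_add) \<Rightarrow> real) \<Rightarrow> bool" where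
  "direct_sum_norm scl I X nrm p \<longleftrightarrow>
     complex_normed_space (fun_scale scl) (tuples I X) p
     \<and> homeomorphic_map (nrm_topology (tuples I X) p)
          (product_topology (\<lambda>i. nrm_topology (X i) (nrm i)) I) (\<lambda>x. restrict x I)"

context complex_normed_space
begin

lemma zero_mem: "0 \<in> X"
  using carrier_subspace by (rule subspace_0)

lemma add_mem: "x \<in> X \<Longrightarrow> y \<in> X \<Longrightarrow> x + y \<in> X"
  using carrier_subspace by (rule subspace_add)

lemma diff_mem: "x \<in> X \<Longrightarrow> y \<in> X \<Longrightarrow> x - y \<in> X"
  using carrier_subspace by (rule subspace_diff)

lemma scale_mem: "x \<in> X \<Longrightarrow> scl c x \<in> X"
  using carrier_subspace by (rule subspace_scale)

lemma nrm_minus: "x \<in> X \<Longrightarrow> nrm (- x) = nrm x"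
  using nrm_scale[of x "-1"] by simp

lemma nrm_nonneg: assumes "x \<in> X" shows "0 \<le> nrm x"
proof -
  have "nrm (x + - x) \<le> nrm x + nrm (- x)"
    using assms nrm_triangle[of x "- x"] diff_mem[OF zero_mem assms] by simp
  then show ?thesis
    using nrm_minus[OF assms] nrm_eq_0[OF zero_mem] by simp
qed

sublocale Metric_space X "nrm_dist X nrm"
proof
  fix x y z :: 'a
  show "0 \<le> nrm_dist X nrm x y"
    by (simp add: nrm_dist_def nrm_nonneg diff_mem)
  show "nrm_dist X nrm x y = nrm_dist X nrm y x"
    using nrm_minus[of "x - y"] by (auto simp: nrm_dist_def diff_mem)
  show "nrm_dist X nrm x y = 0 \<longleftrightarrow> x = y" if "x \<in> X" "y \<in> X"
    using that nrm_eq_0[of "x - y"] by (simp add: nrm_dist_def diff_mem)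
  show "nrm_dist X nrm x z \<le> nrm_dist X nrm x y + nrm_dist X nrm y z"
    if "x \<in> X" "y \<in> X" "z \<in> X"
    using that nrm_triangle[of "x - y" "y - z"] by (simp add: nrm_dist_def diff_mem)
qed

lemma topspace_nrm_topology [simp]: "topspace (nrm_topology X nrm) = X"
  by (simp add: nrm_topology_def)

end

lemma vector_space_fun_scale:
  assumes "vector_space scl"
  shows "vector_space (fun_scale scl)"
proof -
  interpret vector_space scl by fact
  show ?thesis
    by unfold_locales (auto simp: fun_scale_def scale_right_distrib scale_left_distrib)
qed

text \<open>In particular the norm of the Hilbert direct sum is admissible.\<close>

proposition direct_sum_norm_L2:
  fixes scl :: "complex \<Rightarrow> 'a::ab_group_add \<Rightarrow> 'a"
  assumes I: "finite I" "I \<noteq> {}"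
    and X: "\<And>i. i \<in> I \<Longrightarrow> complex_normed_space scl (X i) (nrm i)"
  shows "direct_sum_norm scl I X nrm (\<lambda>x. L2_set (\<lambda>i. nrm i (x i)) I)"
proof -
  let ?p = "\<lambda>x. L2_set (\<lambda>i. nrm i (x i)) I"
  let ?H = "tuples I X"
  have vs: "vector_space scl"
    using I X complex_normed_space_def by blast
  interpret V: vector_space scl by (rule vs)
  interpret F: vector_space "fun_scale scl" by (rule vector_space_fun_scale[OF vs])
  have N: "complex_normed_space (fun_scale scl) ?H ?p"
  proof
    show "F.subspace ?H"
      unfolding F.subspace_def tuples_def
      using complex_normed_space.zero_mem[OF X] complex_normed_space.add_mem[OF X]
        complex_normed_space.scale_mem[OF X]
      by (auto simp: fun_scale_def)
    fix x y and c :: complex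
    assume x: "x \<in> ?H"
    have "?p x = 0 \<longleftrightarrow> (\<forall>i\<in>I. nrm i (x i) = 0)"
      using I by (simp add: L2_set_eq_0_iff)
    also have "\<dots> \<longleftrightarrow> (\<forall>i\<in>I. x i = 0)"
      using x complex_normed_space.nrm_eq_0[OF X] by (auto simp: tuples_def)
    also have "\<dots> \<longleftrightarrow> x = 0"
      using x by (auto simp: tuples_def fun_eq_iff)
    finally show "?p x = 0 \<longleftrightarrow> x = 0" .
    have "?p (fun_scale scl c x) = L2_set (\<lambda>i. cmod c * nrm i (x i)) I"
      using x complex_normed_space.nrm_scale[OF X]
      by (intro L2_set_cong) (auto simp: tuples_def fun_scale_def)
    then show "?p (fun_scale scl c x) = cmod c * ?p x"
      by (simp add: L2_set_right_distrib)
    assume y: "y \<in> ?H"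
    have "?p (x + y) \<le> L2_set (\<lambda>i. nrm i (x i) + nrm i (y i)) I"
      using x y complex_normed_space.nrm_triangle[OF X] complex_normed_space.nrm_nonneg[OF X]
        complex_normed_space.add_mem[OF X]
      by (intro L2_set_mono) (auto simp: tuples_def)
    also have "\<dots> \<le> ?p x + ?p y"
      by (rule L2_set_triangle_ineq)
    finally show "?p (x + y) \<le> ?p x + ?p y" .
  qed
  interpret H: complex_normed_space "fun_scale scl" ?H ?p by (rule N)
  let ?TH = "nrm_topology ?H ?p"
  let ?TX = "\<lambda>i. nrm_topology (X i) (nrm i)"
  let ?ext = "\<lambda>x i. if i \<in> I then x i else 0"
  have ext: "?ext x \<in> ?H" if "x \<in> Pi\<^sub>E I X" for x
    using that by (auto simp: tuples_def)
  have le: "nrm_dist (X i) (nrm i) (x i) (y i) \<le> nrm_dist ?H ?p x y"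
    if "i \<in> I" "x \<in> ?H" "y \<in> ?H" for i x y
    using that I member_le_L2_set[of I i "\<lambda>i. nrm i ((x - y) i)"]
    by (auto simp: nrm_dist_def tuples_def)
  have "continuous_map ?TH (?TX i) (\<lambda>x. x i)" if i: "i \<in> I" for i
  proof -
    interpret Xi: complex_normed_space scl "X i" "nrm i" by (rule X[OF i])
    show ?thesis
      unfolding nrm_topology_def H.metric_continuous_map[OF Xi.Metric_space_axioms]
    proof (intro conjI ballI allI impI)
      show "(\<lambda>x. x i) ` ?H \<subseteq> X i"
        using i by (auto simp: tuples_def)
      fix a and e :: real assume "a \<in> ?H" "e > 0"
      then show "\<exists>d>0. \<forall>x. x \<in> ?H \<and> nrm_dist ?H ?p a x < d
          \<longrightarrow> nrm_dist (X i) (nrm i) (a i) (x i) < e"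
        using le[OF i] by (meson order_le_less_trans)
    qed
  qed
  then have c1: "continuous_map ?TH (product_topology ?TX I) (\<lambda>x. restrict x I)"
    by (auto simp: continuous_map_componentwise)
  have c2: "continuous_map (product_topology ?TX I) ?TH ?ext"
    unfolding nrm_topology_def[of ?H] H.continuous_map_to_metric
  proof (intro ballI allI impI)
    fix x and e :: real
    assume "x \<in> topspace (product_topology ?TX I)" and e: "e > 0"
    then have x: "x \<in> Pi\<^sub>E I X"
      using complex_normed_space.topspace_nrm_topology[OF X] by (auto simp: PiE_iff)
    define d where "d = e / (1 + real (card I))"
    have d: "d > 0" using e by (simp add: d_def)
    let ?B = "\<lambda>i. Metric_space.mball (X i) (nrm_dist (X i) (nrm i)) (x i) d"
    have B: "openin (?TX i) (?B i) \<and> x i \<in> ?B i" if i: "i \<in> I" for i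
    proof -
      interpret Xi: complex_normed_space scl "X i" "nrm i" by (rule X[OF i])
      have "x i \<in> X i" using x i by auto
      then show ?thesis using d by (simp add: nrm_topology_def)
    qed
    have "openin (product_topology ?TX I) (Pi\<^sub>E I ?B)"
      using B I by (simp add: openin_PiE_gen)
    moreover have "x \<in> Pi\<^sub>E I ?B"
      using B x by (auto simp: PiE_iff)
    moreover have "?ext y \<in> H.mball (?ext x) e" if y: "y \<in> Pi\<^sub>E I ?B" for y
    proof -
      have *: "y i \<in> X i \<and> nrm i (x i - y i) < d \<and> 0 \<le> nrm i (x i - y i)" if i: "i \<in> I" for i
      proof -
        interpret Xi: complex_normed_space scl "X i" "nrm i" by (rule X[OF i])
        have "x i \<in> X i" using x i by auto
        moreover have "y i \<in> X i \<and> nrm_dist (X i) (nrm i) (x i) (y i) < d"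
          using y i by (auto simp: PiE_iff dest!: bspec[of I])
        ultimately show ?thesis
          using Xi.nrm_nonneg Xi.diff_mem by (auto simp: nrm_dist_def)
      qed
      then have yX: "y \<in> Pi\<^sub>E I X"
        using y by (auto simp: PiE_iff)
      have "?p (?ext x - ?ext y) = L2_set (\<lambda>i. nrm i (x i - y i)) I"
        by (intro L2_set_cong) auto
      also have "\<dots> \<le> (\<Sum>i\<in>I. nrm i (x i - y i))"
        using * by (intro L2_set_le_sum) auto
      also have "\<dots> \<le> (\<Sum>i\<in>I. d)"
        using * by (intro sum_mono) (auto intro: less_imp_le)
      also have "\<dots> < e"
        using e by (simp add: d_def field_simps)
      finally show ?thesis
        using ext[OF x] ext[OF yX] by (simp add: nrm_dist_def)
    qed
    ultimately show "\<exists>U. openin (product_topology ?TX I) U \<and> x \<in> U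
        \<and> (\<forall>y\<in>U. ?ext y \<in> H.mball (?ext x) e)"
      by blast
  qed
  have "homeomorphic_maps ?TH (product_topology ?TX I) (\<lambda>x. restrict x I) ?ext"
    unfolding homeomorphic_maps_def H.topspace_nrm_topology
  proof (intro conjI ballI c1 c2)
    show "?ext (restrict x I) = x" if "x \<in> ?H" for x
      using that by (auto simp: tuples_def fun_eq_iff)
    show "restrict (?ext x) I = x" if "x \<in> topspace (product_topology ?TX I)" for x
      using that by (auto simp: fun_eq_iff PiE_iff extensional_def)
  qed
  then show ?thesis
    unfolding direct_sum_norm_def using N homeomorphic_maps_map by blast
qed

end

theory Submission
  imports Defs
begin

text \<open>
  The eigenvectors of a direct sum are the tuples whose entries are zero or eigenvectors for one
  common eigenvalue, so the span of the eigenvectors is the product of the spans, and closures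
  commute with finite products (\<open>direct_sum_eigenvector_closure\<close>). It remains to
  treat one operator \<open>T\<close>. A linear combination of unimodular eigenvectors returns
  close to itself along a syndetic set, because a point of a finite-dimensional torus does so
  under a rotation; hence the span of the eigenvectors consists of uniformly recurrent vectors
  with bounded orbit. The other inclusion rests on one elementary device. For a window of length
  \<open>N\<close> let \<open>u_z\<close>, for \<open>z ^ N = 1\<close>, be the mean of
  \<open>cnj z ^ k\<close> times \<open>T\<^sup>k x\<close> over \<open>k < N\<close>: the
  finite Fourier transform of the orbit segment. By telescoping, \<open>(T - z) u_z\<close> has
  norm at most \<open>2 K / N\<close> if \<open>K\<close> bounds the orbit, so that every
  \<open>u_z\<close> that is not small is an approximate eigenvector.

  \<^bold>\<open>Hilbert spaces.\<close> If \<open>x\<close> is not in the closed span of the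
  eigenvectors, some \<open>y\<close> is orthogonal to all of them but not to \<open>x\<close>.
  Weak compactness turns orthogonality to the eigenvectors into an estimate
  \<open>\<bar>\<langle>v, y\<rangle>\<bar> \<le> e \<parallel>v\<parallel> + W \<parallel>(T -
  z) v\<parallel>\<close> for all \<open>v\<close> and all unimodular \<open>z\<close>, with
  arbitrarily small \<open>e\<close> and with \<open>W\<close> independent of \<open>z\<close>
  (\<open>orthogonality_estimate_from_eigenvectors\<close>). By Parseval, the sum of
  \<open>\<bar>\<langle>u_z, y\<rangle>\<bar>\<^sup>2\<close> over \<open>z\<close> is the mean
  of \<open>\<bar>\<langle>T\<^sup>k x, y\<rangle>\<bar>\<^sup>2\<close> over the window, which
  stays away from 0 on windows where \<open>x\<close> returns with positive frequency. The
  estimate bounds the same sum by \<open>2 e\<^sup>2 K\<^sup>2 + 8 W\<^sup>2 K\<^sup>2 /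
  N\<close>, since the sum of \<open>\<parallel>u_z\<parallel>\<^sup>2\<close> is at most
  \<open>K\<^sup>2\<close>, and this is a contradiction for small \<open>e\<close> and large
  \<open>N\<close>.

  \<^bold>\<open>Power-bounded operators.\<close> The orbit of a uniformly recurrent
  \<open>x\<close> is totally bounded, and so is the set of all \<open>u_z\<close>; therefore,
  for large \<open>N\<close>, all \<open>u_z\<close> are uniformly close to eigenvectors or to 0
  (\<open>fourier_near_span_E\<close>). To recover \<open>x\<close> from the \<open>u_z\<close>,
  let \<open>A\<close> be a set of almost periods. The differences of almost periods are almost
  periods, so \<open>x\<close> is close to the mean of \<open>T\<^sup>k x\<close> over \<open>k
  = j - i\<close> modulo \<open>N\<close> with \<open>i, j\<close> in \<open>A\<close> and below
  \<open>N\<close>. That mean is a combination of the \<open>u_z\<close> whose coefficients are,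
  up to a constant factor, the squared moduli of the Fourier transform of \<open>A\<close>. They
  are nonnegative with bounded sum, so replacing each \<open>u_z\<close> by a nearby eigenvector
  costs little (\<open>URec_subset_closure_span\<close>).
\<close>

section \<open>Sums over roots of unity\<close>

lemma unimodular_mult_cnj: "cmod z = 1 \<Longrightarrow> z * cnj z = 1"
  by (simp add: complex_norm_square[symmetric])

lemma unimodular_if_root_of_unity: "z ^ N = 1 \<Longrightarrow> N > 0 \<Longrightarrow> cmod z = 1" for z :: complex
  using norm_power[of z N] power_eq_imp_eq_base[of "cmod z" N 1] by simp

text \<open>Multiplication by a primitive root permutes the roots and multiplies the sum by the
  \<open>k\<close>-th power of that root.\<close>

lemma sum_powers_roots_of_unity:
  assumes N: "N > 0"
  shows "(\<Sum>z | z ^ N = 1. z ^ k) = (if N dvd k then of_nat N else (0::complex))"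
proof (cases "N dvd k")
  case True
  then obtain q where "k = N * q" by (rule dvdE)
  then show ?thesis
    using card_roots_unity_eq[OF N] by (simp add: power_mult)
next
  case False
  let ?R = "{z::complex. z ^ N = 1}"
  let ?w = "cis (2 * pi / real N)"
  have wN: "?w ^ N = 1"
    using N by (subst Complex.DeMoivre) simp
  have w0: "?w \<noteq> 0" by simp
  have inj: "inj_on (\<lambda>j. cis (2 * pi * real j / real N)) {..<N}"
    using Complex.bij_betw_roots_unity[OF N] by (simp add: bij_betw_def)
  have wk: "?w ^ k \<noteq> 1"
  proof
    assume "?w ^ k = 1"
    moreover have "?w ^ k = ?w ^ (k mod N)"
      by (metis wN mult_1 mult_div_mod_eq power_add power_mult power_one)
    ultimately have "?w ^ (k mod N) = 1" by simp
    then have "cis (2 * pi * real (k mod N) / real N) = cis (2 * pi * real 0 / real N)"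
      by (simp add: Complex.DeMoivre mult_ac)
    with inj N have "k mod N = 0"
      using inj_onD[OF inj, of "k mod N" 0] by simp
    with False show False by (simp add: dvd_eq_mod_eq_0)
  qed
  have "(\<Sum>z\<in>?R. z ^ k) = (\<Sum>z\<in>?R. (?w * z) ^ k)"
  proof (rule sum.reindex_bij_witness[where i = "\<lambda>z. ?w * z" and j = "\<lambda>z. z / ?w"])
  qed (use wN w0 in \<open>auto simp: power_mult_distrib power_divide\<close>)
  also have "\<dots> = ?w ^ k * (\<Sum>z\<in>?R. z ^ k)"
    by (simp add: power_mult_distrib sum_distrib_left)
  finally show ?thesis
    using wk False by simp
qed

lemma cnj_root_of_unity_power:
  assumes "z ^ N = 1" "N > 0" "k \<le> N"
  shows "cnj z ^ k = z ^ (N - k)"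
proof -
  have "z * cnj z = 1"
    using assms by (intro unimodular_mult_cnj unimodular_if_root_of_unity)
  then have "z ^ k * cnj z ^ k = 1"
    by (metis power_mult_distrib power_one)
  then have "cnj z ^ k = z ^ N * cnj z ^ k" "z ^ (N - k) * (z ^ k * cnj z ^ k) = z ^ (N - k)"
    using assms by simp_all
  then show ?thesis
    using assms(3) by (metis le_add_diff_inverse2 mult.assoc power_add)
qed

lemma roots_of_unity_orthogonal:
  assumes "j < N" "k < N"
  shows "(\<Sum>z | z ^ N = 1. z ^ j * cnj z ^ k) = (if j = k then of_nat N else 0)"
proof -
  have "(\<Sum>z | z ^ N = 1. z ^ j * cnj z ^ k) = (\<Sum>z | z ^ N = 1. z ^ (j + (N - k)))"
  proof (intro sum.cong refl)
    fix z :: complex assume "z \<in> {z. z ^ N = 1}"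
    then have "cnj z ^ k = z ^ (N - k)"
      using assms by (intro cnj_root_of_unity_power) auto
    then show "z ^ j * cnj z ^ k = z ^ (j + (N - k))"
      by (simp only: power_add)
  qed
  moreover have "N dvd j + (N - k) \<longleftrightarrow> j = k"
  proof
    assume "N dvd j + (N - k)"
    then obtain q where q: "j + (N - k) = N * q" by (rule dvdE)
    then have "N * q < N * 2" "0 < N * q" using assms by linarith+
    then have "q = 1" using assms by (cases q) (auto simp: less_Suc_eq)
    with q assms show "j = k" by simp
  qed (use assms in simp)
  ultimately show ?thesis
    using assms by (subst (asm) sum_powers_roots_of_unity) auto
qed

text \<open>The cyclic difference of the two exponents appears because the roots only see exponents modulo
  \<open>N\<close>. This is the identity that turns a weighted sum of Fourier coefficients into
  a sum of orbit points.\<close>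

lemma roots_of_unity_triple:
  assumes "i < N" "j < N" "k < N"
  shows "(\<Sum>z | z ^ N = 1. z ^ j * cnj z ^ i * cnj z ^ k)
     = (if k = (j + N - i) mod N then of_nat N else 0)"
proof -
  have *: "z ^ j * cnj z ^ i = z ^ ((j + N - i) mod N)" if "z ^ N = 1" for z
  proof -
    have "z ^ j * cnj z ^ i = z ^ (j + N - i)"
      using assms that by (simp add: cnj_root_of_unity_power flip: power_add)
    also have "\<dots> = z ^ ((j + N - i) mod N)"
      by (metis that mult_1 mult_div_mod_eq power_add power_mult power_one)
    finally show ?thesis .
  qed
  have "(\<Sum>z | z ^ N = 1. z ^ j * cnj z ^ i * cnj z ^ k)
      = (\<Sum>z | z ^ N = 1. z ^ ((j + N - i) mod N) * cnj z ^ k)"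
    by (intro sum.cong) (auto simp: *)
  then show ?thesis
    using assms by (subst (asm) roots_of_unity_orthogonal) auto
qed

text \<open>Parseval for an arbitrary matrix \<open>h\<close> instead of a product, so that it serves
  vectors, with \<open>h\<close> their Gram matrix, and scalars alike.\<close>

lemma roots_of_unity_Parseval:
  fixes h :: "nat \<Rightarrow> nat \<Rightarrow> complex"
  shows "(\<Sum>z | z ^ N = 1. \<Sum>j<N. \<Sum>k<N. cnj z ^ j * z ^ k * h j k) = of_nat N * (\<Sum>j<N. h j j)"
proof -
  have "(\<Sum>z | z ^ N = 1. \<Sum>j<N. \<Sum>k<N. cnj z ^ j * z ^ k * h j k)
      = (\<Sum>j<N. \<Sum>k<N. (\<Sum>z | z ^ N = 1. z ^ k * cnj z ^ j) * h j k)"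
  proof -
    have "(\<Sum>z | z ^ N = 1. \<Sum>j<N. \<Sum>k<N. cnj z ^ j * z ^ k * h j k)
        = (\<Sum>j<N. \<Sum>z | z ^ N = 1. \<Sum>k<N. cnj z ^ j * z ^ k * h j k)"
      by (rule sum.swap)
    also have "\<dots> = (\<Sum>j<N. \<Sum>k<N. \<Sum>z | z ^ N = 1. cnj z ^ j * z ^ k * h j k)"
      by (intro sum.cong refl sum.swap)
    also have "\<dots> = (\<Sum>j<N. \<Sum>k<N. (\<Sum>z | z ^ N = 1. z ^ k * cnj z ^ j) * h j k)"
      unfolding sum_distrib_right by (intro sum.cong refl) (simp add: mult_ac)
    finally show ?thesis .
  qed
  also have "\<dots> = (\<Sum>j<N. \<Sum>k<N. if k = j then of_nat N * h j k else 0)"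
    by (intro sum.cong refl) (subst roots_of_unity_orthogonal; auto)
  finally show ?thesis
    by (simp add: sum.delta' sum.delta sum_distrib_left)
qed

section \<open>Syndetic sets and Banach density\<close>

text \<open>By the pigeonhole principle: up to \<open>e\<close>, the points of the torus take finitely
  many values, so that finitely many representatives \<open>r\<close> approximate the whole
  orbit; since rotations are isometries, \<open>n - r\<close> is a return time if
  \<open>r\<close> represents \<open>n\<close>.\<close>

lemma simultaneous_returns_syndetic:
  fixes \<mu> :: "'t \<Rightarrow> complex"
  assumes F: "finite F" and \<mu>: "\<And>a. a \<in> F \<Longrightarrow> cmod (\<mu> a) = 1" and e: "e > 0"
  shows "syndetic {n. \<forall>a\<in>F. cmod (\<mu> a ^ n - 1) < e}"
proof -
  have "compact (sphere (0::complex) 1)" by simp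
  then obtain Z where Z: "finite Z" "sphere (0::complex) 1 \<subseteq> (\<Union>z\<in>Z. ball z (e/2))"
    using compactE_image[of "sphere (0::complex) 1" "sphere 0 1" "\<lambda>z. ball z (e/2)"] e
    by (metis (no_types, lifting) UN_I centre_in_ball half_gt_zero open_ball subsetI)
  have "\<forall>w. \<exists>z. cmod w = 1 \<longrightarrow> z \<in> Z \<and> dist z w < e/2"
  proof
    fix w show "\<exists>z. cmod w = 1 \<longrightarrow> z \<in> Z \<and> dist z w < e/2"
      using subsetD[OF Z(2), of w] by (cases "cmod w = 1") auto
  qed
  then obtain c where c: "\<And>w. cmod w = 1 \<Longrightarrow> c w \<in> Z \<and> dist (c w) w < e/2"
    by metis
  define g where "g = (\<lambda>n. restrict (\<lambda>a. c (\<mu> a ^ n)) F)"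
  have "range g \<subseteq> Pi\<^sub>E F (\<lambda>_. Z)"
    using c \<mu> by (auto simp: g_def norm_power)
  then have fin: "finite (range g)"
    using finite_PiE[OF F] Z by (meson finite_subset)
  \<comment> \<open>The first time at which the orbit visits the given cell of the net.\<close>
  define rep where "rep = (\<lambda>v. LEAST n. g n = v)"
  have rep: "g (rep (g n)) = g n" for n
    unfolding rep_def by (rule LeastI) simp
  define M where "M = Max (rep ` range g)"
  have M: "rep (g n) \<le> M" for n
    unfolding M_def using fin by (intro Max_ge) auto
  have "\<exists>n\<in>{x..x + (M + 1)}. \<forall>a\<in>F. cmod (\<mu> a ^ n - 1) < e" for x
  proof (intro bexI[of _ "x + M - rep (g (x + M))"] ballI)
    fix a assume a: "a \<in> F"
    let ?n = "x + M" let ?r = "rep (g (x + M))"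
    have "g ?r a = g ?n a" by (simp add: rep)
    then have "c (\<mu> a ^ ?r) = c (\<mu> a ^ ?n)" using a by (simp add: g_def)
    then have "dist (\<mu> a ^ ?n) (\<mu> a ^ ?r) < e"
      using c[of "\<mu> a ^ ?n"] c[of "\<mu> a ^ ?r"] \<mu>[OF a]
      by (metis dist_triangle_half_r norm_power power_one)
    moreover have "\<mu> a ^ ?n - \<mu> a ^ ?r = \<mu> a ^ ?r * (\<mu> a ^ (?n - ?r) - 1)"
      using M[of ?n] by (simp add: right_diff_distrib flip: power_add)
    ultimately show "cmod (\<mu> a ^ (?n - ?r) - 1) < e"
      using \<mu>[OF a] by (simp add: dist_norm norm_mult norm_power)
  qed (use M[of "x + M"] in auto)
  then show ?thesis
    unfolding syndetic_def by (intro exI[of _ "M + 1"]) auto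
qed

lemma syndetic_mono: "syndetic A \<Longrightarrow> A \<subseteq> B \<Longrightarrow> syndetic B"
  unfolding syndetic_def by (meson disjoint_iff subsetD)

text \<open>Each of the \<open>n div q\<close> consecutive blocks of length \<open>q\<close> below
  \<open>n\<close> contains a point of \<open>A\<close>; the factor 2 absorbs the rounding.\<close>

lemma syndetic_card:
  assumes "syndetic A"
  obtains q :: nat where "q \<ge> 1" "\<And>n. n \<ge> q \<Longrightarrow> n \<le> 2 * q * card (A \<inter> {..<n})"
proof -
  obtain m where m: "m \<ge> 1" "\<And>x. {x..x + m} \<inter> A \<noteq> {}"
    using assms by (auto simp: syndetic_def)
  let ?q = "m + 1"
  have "n \<le> 2 * ?q * card (A \<inter> {..<n})" if n: "n \<ge> ?q" for n
  proof -
    have "\<forall>j. \<exists>a. a \<in> A \<and> ?q * j \<le> a \<and> a < ?q * Suc j"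
    proof
      fix j show "\<exists>a. a \<in> A \<and> ?q * j \<le> a \<and> a < ?q * Suc j"
      proof -
        obtain a where "a \<in> {?q * j..?q * j + m} \<inter> A"
          using m(2)[of "?q * j"] by blast
        then show ?thesis by (intro exI[of _ a]) auto
      qed
    qed
    then obtain s where s: "\<And>j. s j \<in> A" "\<And>j. ?q * j \<le> s j" "\<And>j. s j < ?q * Suc j"
      by metis
    have div: "s j div ?q = j" for j
      using s(2,3)[of j] by (intro div_nat_eqI) (auto simp: mult_ac)
    have "s ` {..<n div ?q} \<subseteq> A \<inter> {..<n}"
    proof (rule image_subsetI)
      fix j assume "j \<in> {..<n div ?q}"
      then have "?q * Suc j \<le> ?q * (n div ?q)" by (intro mult_le_mono) auto
      also have "\<dots> \<le> n" by (rule times_div_less_eq_dividend)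
      finally show "s j \<in> A \<inter> {..<n}" using s(1,3)[of j] by simp
    qed
    then have "card (s ` {..<n div ?q}) \<le> card (A \<inter> {..<n})"
      by (intro card_mono) auto
    moreover have "inj_on s {..<n div ?q}"
      by (metis div inj_onI)
    ultimately have "n div ?q \<le> card (A \<inter> {..<n})"
      by (simp add: card_image)
    moreover have "n \<le> 2 * ?q * (n div ?q)"
    proof -
      define t where "t = ?q * (n div ?q)"
      have "n = t + n mod ?q" unfolding t_def by (simp only: mult_div_mod_eq)
      moreover have "n mod ?q \<le> ?q" by simp
      moreover have "?q * 1 \<le> t"
        unfolding t_def using n by (intro mult_le_mono) (auto simp: div_greater_zero_iff Suc_le_eq)
      ultimately have "n \<le> 2 * t" by (metis add_mono le_trans mult_2 mult_1_right order_refl)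
      then show ?thesis by (simp only: t_def mult.assoc)
    qed
    ultimately show ?thesis
      by (meson le_trans mult_le_mono2)
  qed
  then show ?thesis using that[of ?q] by simp
qed

text \<open>The maximum in the definition of the upper Banach density is only meaningful on a finite set.\<close>

lemma banach_density_finite_values:
  "finite (range (\<lambda>m. real (card (A \<inter> {m..m + L})) / real (L + 1)))"
proof (rule finite_subset)
  show "range (\<lambda>m. real (card (A \<inter> {m..m + L})) / real (L + 1))
      \<subseteq> (\<lambda>c. real c / real (L + 1)) ` {..L + 1}"
  proof safe
    fix m
    have "card (A \<inter> {m..m + L}) \<le> card {m..m + L}" by (intro card_mono) auto
    then show "real (card (A \<inter> {m..m + L})) / real (L + 1) \<in> (\<lambda>c. real c / real (L + 1)) ` {..L + 1}"
      by auto
  qed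
qed simp

lemma upper_banach_density_pos_if_syndetic:
  assumes "syndetic A"
  shows "upper_banach_density A > 0"
proof -
  obtain q where q: "q \<ge> 1" "\<And>n. n \<ge> q \<Longrightarrow> n \<le> 2 * q * card (A \<inter> {..<n})"
    using assms syndetic_card by blast
  let ?d = "\<lambda>L m. real (card (A \<inter> {m..m + L})) / real (L + 1)"
  have "1 / (2 * real q) \<le> Max (range (?d L))" if "L \<ge> q" for L
  proof -
    have "real (L + 1) \<le> real (2 * q * card (A \<inter> {..<L + 1}))"
      using q(2)[of "L + 1"] that by (intro of_nat_mono) simp
    moreover have "{..<L + 1} = {0..0 + L}" by auto
    ultimately have "1 / (2 * real q) \<le> ?d L 0"
      using q(1) by (simp add: field_simps)
    also have "\<dots> \<le> Max (range (?d L))"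
      by (intro Max_ge banach_density_finite_values rangeI)
    finally show ?thesis .
  qed
  then have "ereal (1 / (2 * real q)) \<le> upper_banach_density A"
    unfolding upper_banach_density_def
    by (intro le_Limsup) (auto simp: eventually_sequentially intro!: exI[of _ q])
  moreover have "0 < ereal (1 / (2 * real q))" using q(1) by simp
  ultimately show ?thesis by (rule less_le_trans[rotated])
qed

lemma dense_windows_if_upper_banach_density_pos:
  assumes "upper_banach_density A > 0"
  obtains d :: real where "d > 0" "\<And>L0. \<exists>N\<ge>L0. \<exists>m. N > 0 \<and> d * real N \<le> real (card (A \<inter> {m..<m + N}))"
proof -
  let ?d = "\<lambda>L m. real (card (A \<inter> {m..m + L})) / real (L + 1)"
  obtain d where d: "0 < ereal d" "ereal d < upper_banach_density A"
    using assms ereal_dense2 by blast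
  have "\<exists>N\<ge>L0. \<exists>m. N > 0 \<and> d * real N \<le> real (card (A \<inter> {m..<m + N}))" for L0
  proof (rule ccontr)
    assume *: "\<not> ?thesis"
    have "Max (range (?d L)) \<le> d" if "L \<ge> L0" for L
    proof -
      have "?d L m \<le> d" for m
      proof -
        have "\<not> d * real (L + 1) \<le> real (card (A \<inter> {m..<m + (L + 1)}))"
          using * that by (metis add_gr_0 le_add1 le_trans zero_less_one)
        moreover have "{m..<m + (L + 1)} = {m..m + L}" by auto
        ultimately show ?thesis by (simp add: pos_divide_le_eq)
      qed
      then show ?thesis
        by (intro Max.boundedI banach_density_finite_values) auto
    qed
    then have "upper_banach_density A \<le> ereal d"
      unfolding upper_banach_density_def
      by (intro Limsup_bounded) (auto simp: eventually_sequentially intro!: exI[of _ L0])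
    with d(2) show False by simp
  qed
  with d(1) show ?thesis by (intro that[of d]) auto
qed

section \<open>Normed spaces on carriers\<close>

context complex_normed_space
begin

lemma sum_mem: "(\<And>i. i \<in> J \<Longrightarrow> f i \<in> X) \<Longrightarrow> sum f J \<in> X"
  by (rule subspace_sum[OF carrier_subspace])

lemma nrm_zero [simp]: "nrm 0 = 0"
  using nrm_eq_0[OF zero_mem] by simp

lemma nrm_sum_le: "(\<And>i. i \<in> J \<Longrightarrow> f i \<in> X) \<Longrightarrow> nrm (sum f J) \<le> (\<Sum>i\<in>J. nrm (f i))"
proof (induction J rule: infinite_finite_induct)
  case (insert j J)
  then have "nrm (f j + sum f J) \<le> nrm (f j) + nrm (sum f J)"
    by (intro nrm_triangle sum_mem) auto
  with insert show ?case by fastforce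
qed simp_all

lemma nrm_triangle_diff: "x \<in> X \<Longrightarrow> y \<in> X \<Longrightarrow> nrm (x - y) \<le> nrm x + nrm y"
  using nrm_triangle[of x "- y"] nrm_minus[of y] diff_mem[OF zero_mem, of y] by simp

lemma nrm_diff_triangle:
  "x \<in> X \<Longrightarrow> y \<in> X \<Longrightarrow> z \<in> X \<Longrightarrow> nrm (x - z) \<le> nrm (x - y) + nrm (y - z)"
  using nrm_triangle[of "x - y" "y - z"] by (simp add: diff_mem)

lemma nrm_le_add: "x \<in> X \<Longrightarrow> y \<in> X \<Longrightarrow> nrm x \<le> nrm y + nrm (x - y)"
  using nrm_triangle[of y "x - y"] by (simp add: diff_mem)

lemma nrm_commute: "x \<in> X \<Longrightarrow> y \<in> X \<Longrightarrow> nrm (x - y) = nrm (y - x)"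
  using nrm_minus[of "x - y"] by (simp add: diff_mem)

lemma mem_nrm_closure_iff:
  assumes "A \<subseteq> X"
  shows "z \<in> nrm_closure X nrm A \<longleftrightarrow> z \<in> X \<and> (\<forall>e>0. \<exists>a\<in>A. nrm (z - a) < e)"
  using assms unfolding nrm_closure_def nrm_topology_def metric_closure_of
  by (fastforce simp: nrm_dist_def)

lemma nrm_closure_subset: "nrm_closure X nrm A \<subseteq> X"
  unfolding nrm_closure_def using closure_of_subset_topspace[of "nrm_topology X nrm"] by simp

lemma subset_nrm_closure: "A \<subseteq> X \<Longrightarrow> A \<subseteq> nrm_closure X nrm A"
  unfolding nrm_closure_def by (rule closure_of_subset) simp

lemma nrm_closure_mono: "A \<subseteq> B \<Longrightarrow> nrm_closure X nrm A \<subseteq> nrm_closure X nrm B"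
  unfolding nrm_closure_def by (rule closure_of_mono)

lemma nrm_closure_minimal:
  "A \<subseteq> nrm_closure X nrm B \<Longrightarrow> nrm_closure X nrm A \<subseteq> nrm_closure X nrm B"
  unfolding nrm_closure_def by (rule closure_of_minimal) auto

lemma ball_in_nrm_nhds:
  assumes "x \<in> X" "e > 0"
  shows "{z \<in> X. nrm (z - x) < e} \<in> nrm_nhds X nrm x"
proof -
  have "mball x e = {z \<in> X. nrm (z - x) < e}"
    using assms nrm_commute by (auto simp: nrm_dist_def)
  then show ?thesis
    unfolding nrm_nhds_def nrm_topology_def using assms by (metis (no_types, lifting)
      centre_in_mball_iff mball_subset_mspace mem_Collect_eq openin_mball order_refl)
qed

lemma nrm_nhds_contains_ball:
  assumes "U \<in> nrm_nhds X nrm x"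
  obtains e where "e > 0" "{z \<in> X. nrm (z - x) < e} \<subseteq> U" "x \<in> X"
proof -
  obtain V where V: "openin mtopology V" "x \<in> V" "V \<subseteq> U"
    using assms unfolding nrm_nhds_def nrm_topology_def by auto
  then obtain e where e: "e > 0" "mball x e \<subseteq> V" and x: "x \<in> X"
    unfolding openin_mtopology by blast
  have "{z \<in> X. nrm (z - x) < e} \<subseteq> mball x e"
    using x nrm_commute by (auto simp: nrm_dist_def)
  with e V x show ?thesis by (intro that[of e]) auto
qed

lemma MCauchy_iff_nrm:
  "MCauchy \<sigma> \<longleftrightarrow> range \<sigma> \<subseteq> X \<and> (\<forall>e>0. \<exists>n0. \<forall>m\<ge>n0. \<forall>n\<ge>n0. nrm (\<sigma> m - \<sigma> n) < e)"
  unfolding MCauchy_def by (auto simp: nrm_dist_def image_subset_iff)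

lemma subspace_nrm_closure:
  assumes "subspace S" "S \<subseteq> X"
  shows "subspace (nrm_closure X nrm S)"
proof (rule subspaceI)
  show "0 \<in> nrm_closure X nrm S"
    using subset_nrm_closure[OF assms(2)] subspace_0[OF assms(1)] by auto
next
  fix x y assume xy: "x \<in> nrm_closure X nrm S" "y \<in> nrm_closure X nrm S"
  then have X: "x \<in> X" "y \<in> X" using nrm_closure_subset by auto
  have "\<exists>a\<in>S. nrm (x + y - a) < e" if "e > 0" for e
  proof -
    obtain a b where ab: "a \<in> S" "b \<in> S" "nrm (x - a) < e/2" "nrm (y - b) < e/2"
      using xy \<open>e > 0\<close> mem_nrm_closure_iff[OF assms(2)] by (meson half_gt_zero)
    then have "nrm ((x - a) + (y - b)) \<le> nrm (x - a) + nrm (y - b)"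
      using X assms by (intro nrm_triangle diff_mem) auto
    with ab have "nrm (x + y - (a + b)) < e" by (simp add: algebra_simps)
    with ab assms show ?thesis by (meson subspace_add)
  qed
  then show "x + y \<in> nrm_closure X nrm S"
    using X add_mem by (auto simp: mem_nrm_closure_iff[OF assms(2)])
next
  fix x c assume x: "x \<in> nrm_closure X nrm S"
  then have X: "x \<in> X" using nrm_closure_subset by auto
  have "\<exists>a\<in>S. nrm (scl c x - a) < e" if "e > 0" for e
  proof -
    have "e / (cmod c + 1) > 0" using that by (simp add: add_nonneg_pos)
    then obtain a where a: "a \<in> S" "nrm (x - a) < e / (cmod c + 1)"
      using x mem_nrm_closure_iff[OF assms(2)] by meson
    have *: "x - a \<in> X" using X a assms by (auto intro: diff_mem)
    have "nrm (scl c x - scl c a) = cmod c * nrm (x - a)"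
      using nrm_scale[OF *] by (simp add: scale_right_diff_distrib)
    also have "\<dots> \<le> (cmod c + 1) * nrm (x - a)"
      using nrm_nonneg[OF *] by (intro mult_right_mono) auto
    also have "\<dots> < e"
      using a(2) by (metis add_nonneg_pos mult.commute norm_ge_zero pos_less_divide_eq zero_less_one)
    finally show ?thesis
      using a assms(1) by (meson subspace_scale)
  qed
  then show "scl c x \<in> nrm_closure X nrm S"
    using X scale_mem by (auto simp: mem_nrm_closure_iff[OF assms(2)])
qed

end

lemma (in complex_banach_space) nrm_Cauchy_convergent:
  assumes "MCauchy \<sigma>"
  obtains v where "v \<in> X" "(\<lambda>n. nrm (\<sigma> n - v)) \<longlonglongrightarrow> 0"
proof -
  obtain v where v: "limitin mtopology \<sigma> v sequentially"
    using complete assms unfolding mcomplete_def by auto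
  then have "v \<in> X" by (simp add: limit_metric_sequentially)
  moreover have "(\<lambda>n. nrm (\<sigma> n - v)) \<longlonglongrightarrow> 0"
  proof (rule LIMSEQ_I)
    fix e :: real assume "e > 0"
    then obtain n0 where "\<forall>n\<ge>n0. \<sigma> n \<in> X \<and> nrm_dist X nrm (\<sigma> n) v < e"
      using v by (auto simp: limit_metric_sequentially)
    then show "\<exists>no. \<forall>n\<ge>no. norm (nrm (\<sigma> n - v) - 0) < e"
      using \<open>v \<in> X\<close> nrm_nonneg diff_mem by (auto simp: nrm_dist_def intro!: exI[of _ n0])
  qed
  ultimately show ?thesis by (rule that)
qed

section \<open>Operators and their unimodular eigenvectors\<close>

locale operator_on_space = complex_normed_space scl X nrm
  for scl :: "complex \<Rightarrow> 'a::ab_group_add \<Rightarrow> 'a" and X nrm +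
  fixes T :: "'a \<Rightarrow> 'a"
  assumes bounded: "bounded_operator scl X nrm T"
begin

abbreviation E where "E \<equiv> unimodular_eigenvectors scl X T"

lemma T_mem: "x \<in> X \<Longrightarrow> T x \<in> X"
  and T_add: "x \<in> X \<Longrightarrow> y \<in> X \<Longrightarrow> T (x + y) = T x + T y"
  and T_scale: "x \<in> X \<Longrightarrow> T (scl c x) = scl c (T x)"
  using bounded by (auto simp: bounded_linear_between_def linear_between_def)

lemma T_bound: obtains K where "K > 0" "\<And>x. x \<in> X \<Longrightarrow> nrm (T x) \<le> K * nrm x"
proof -
  obtain K where K: "\<And>x. x \<in> X \<Longrightarrow> nrm (T x) \<le> K * nrm x"
    using bounded by (auto simp: bounded_linear_between_def)
  have "nrm (T x) \<le> (\<bar>K\<bar> + 1) * nrm x" if "x \<in> X" for x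
    using K[OF that] mult_right_mono[of K "\<bar>K\<bar> + 1" "nrm x"] nrm_nonneg[OF that] by linarith
  then show ?thesis by (intro that[of "\<bar>K\<bar> + 1"]) auto
qed

lemma T_0 [simp]: "T 0 = 0"
  using T_add[of 0 0] zero_mem by simp

lemma T_diff: "x \<in> X \<Longrightarrow> y \<in> X \<Longrightarrow> T (x - y) = T x - T y"
  by (metis T_add diff_add_cancel diff_mem eq_diff_eq)

lemma T_sum: "(\<And>i. i \<in> J \<Longrightarrow> f i \<in> X) \<Longrightarrow> T (sum f J) = (\<Sum>i\<in>J. T (f i))"
proof (induction J rule: infinite_finite_induct)
  case (insert j J)
  then have "T (f j + sum f J) = T (f j) + T (sum f J)"
    by (intro T_add sum_mem) auto
  with insert show ?case by simp
qed simp_all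

lemma pow_mem: "x \<in> X \<Longrightarrow> (T ^^ n) x \<in> X"
  by (induction n) (auto intro: T_mem)

lemma pow_diff: "x \<in> X \<Longrightarrow> y \<in> X \<Longrightarrow> (T ^^ n) (x - y) = (T ^^ n) x - (T ^^ n) y"
  by (induction n) (auto simp: T_diff pow_mem)

lemma E_iff: "v \<in> E \<longleftrightarrow> v \<in> X \<and> v \<noteq> 0 \<and> (\<exists>\<mu>. cmod \<mu> = 1 \<and> T v = scl \<mu> v)"
  unfolding unimodular_eigenvectors_def by (auto dest: sym)

lemma span_E_subset: "span E \<subseteq> X"
  by (rule span_minimal[OF _ carrier_subspace]) (auto simp: E_iff)

lemma eigenspace_subset_span: "v \<in> X \<Longrightarrow> cmod \<mu> = 1 \<Longrightarrow> T v = scl \<mu> v \<Longrightarrow> v \<in> span E"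
  by (cases "v = 0") (auto simp: span_zero E_iff intro!: span_base)

text \<open>The index \<open>a\<close> runs over eigenvectors rather than eigenvalues, so that no
  eigenvectors for equal eigenvalues have to be collected.\<close>

lemma span_E_orbit:
  assumes "x \<in> span E"
  shows "\<exists>(F :: 'a set) \<mu> g. finite F \<and> (\<forall>a\<in>F. cmod (\<mu> a) = 1 \<and> g a \<in> X)
    \<and> (\<forall>n. (T ^^ n) x = (\<Sum>a\<in>F. scl (\<mu> a ^ n) (g a)))"
proof -
  obtain F r where F: "finite F" "F \<subseteq> E" and x: "x = (\<Sum>a\<in>F. scl (r a) a)"
    using assms unfolding span_explicit by blast
  have "\<forall>a. \<exists>m. a \<in> E \<longrightarrow> cmod m = 1 \<and> T a = scl m a"
    by (auto simp: E_iff)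
  then obtain \<mu> where \<mu>: "\<And>a. a \<in> E \<Longrightarrow> cmod (\<mu> a) = 1 \<and> T a = scl (\<mu> a) a"
    by metis
  have FX: "a \<in> X" if "a \<in> F" for a using F that by (auto simp: E_iff)
  have "(T ^^ n) x = (\<Sum>a\<in>F. scl (\<mu> a ^ n) (scl (r a) a))" for n
  proof (induction n)
    case (Suc n)
    then have "(T ^^ Suc n) x = T (\<Sum>a\<in>F. scl (\<mu> a ^ n) (scl (r a) a))" by simp
    also have "\<dots> = (\<Sum>a\<in>F. T (scl (\<mu> a ^ n) (scl (r a) a)))"
      using FX by (intro T_sum scale_mem)
    also have "\<dots> = (\<Sum>a\<in>F. scl (\<mu> a ^ Suc n) (scl (r a) a))"
      using FX F \<mu> by (intro sum.cong refl) (auto simp: T_scale scale_mem mult_ac)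
    finally show ?case .
  qed (simp add: x)
  then show ?thesis
    using F \<mu> FX
    by (intro exI[of _ F] exI[of _ \<mu>] exI[of _ "\<lambda>a. scl (r a) a"]) (auto intro: scale_mem)
qed

lemma span_E_subset_URec: "span E \<subseteq> URec X nrm T"
proof
  fix x assume xs: "x \<in> span E"
  then have x: "x \<in> X" using span_E_subset by auto
  obtain F :: "'a set" and \<mu> g where F: "finite F"
    and \<mu>g: "\<forall>a\<in>F. cmod (\<mu> a) = 1 \<and> g a \<in> X"
    and orb: "\<forall>n. (T ^^ n) x = (\<Sum>a\<in>F. scl (\<mu> a ^ n) (g a))"
    using span_E_orbit[OF xs] by blast
  have \<mu>: "cmod (\<mu> a) = 1" and g: "g a \<in> X" if "a \<in> F" for a
    using \<mu>g that by auto
  have "syndetic (return_set T x U)" if U: "U \<in> nrm_nhds X nrm x" for U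
  proof -
    obtain e where e: "e > 0" "{z \<in> X. nrm (z - x) < e} \<subseteq> U"
      using U by (rule nrm_nhds_contains_ball)
    define G where "G = (\<Sum>a\<in>F. nrm (g a))"
    have G: "G \<ge> 0" unfolding G_def using g nrm_nonneg by (intro sum_nonneg) auto
    define d where "d = e / (G + 1)"
    have d: "d > 0" using e G by (simp add: d_def)
    have "(T ^^ n) x \<in> U" if n: "\<forall>a\<in>F. cmod (\<mu> a ^ n - 1) < d" for n
    proof -
      have "(T ^^ n) x - x = (\<Sum>a\<in>F. scl (\<mu> a ^ n - 1) (g a))"
        using orb[rule_format, of n] orb[rule_format, of 0] by (simp add: scale_left_diff_distrib sum_subtractf)
      also have "nrm \<dots> \<le> (\<Sum>a\<in>F. nrm (scl (\<mu> a ^ n - 1) (g a)))"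
        using g by (intro nrm_sum_le scale_mem)
      also have "\<dots> = (\<Sum>a\<in>F. cmod (\<mu> a ^ n - 1) * nrm (g a))"
        using g by (simp add: nrm_scale)
      also have "\<dots> \<le> (\<Sum>a\<in>F. d * nrm (g a))"
        using n g nrm_nonneg by (intro sum_mono mult_right_mono) (auto intro: less_imp_le)
      also have "\<dots> = d * G" by (simp add: G_def sum_distrib_left)
      also have "\<dots> < e"
        using e G by (simp add: d_def field_simps)
      finally show ?thesis using e x by (auto intro: pow_mem)
    qed
    then show ?thesis
      by (intro syndetic_mono[OF simultaneous_returns_syndetic[OF F \<mu> d]])
        (auto simp: return_set_def)
  qed
  with x show "x \<in> URec X nrm T" by (simp add: URec_def)
qed

lemma span_E_subset_RRec_bo: "span E \<subseteq> RRec_bo X nrm T"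
proof
  fix x assume xs: "x \<in> span E"
  obtain F :: "'a set" and \<mu> g where \<mu>g: "\<forall>a\<in>F. cmod (\<mu> a) = 1 \<and> g a \<in> X"
    and orb: "\<forall>n. (T ^^ n) x = (\<Sum>a\<in>F. scl (\<mu> a ^ n) (g a))"
    using span_E_orbit[OF xs] by blast
  have "nrm ((T ^^ n) x) \<le> (\<Sum>a\<in>F. nrm (g a))" for n
  proof -
    have "nrm ((T ^^ n) x) \<le> (\<Sum>a\<in>F. nrm (scl (\<mu> a ^ n) (g a)))"
      unfolding orb[rule_format] using \<mu>g by (intro nrm_sum_le scale_mem) auto
    also have "\<dots> = (\<Sum>a\<in>F. nrm (g a))"
      using \<mu>g by (intro sum.cong) (auto simp: nrm_scale norm_power)
    finally show ?thesis .
  qed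
  moreover have "x \<in> URec X nrm T" using xs span_E_subset_URec by auto
  ultimately show "x \<in> RRec_bo X nrm T"
    by (auto simp: RRec_bo_def URec_def intro: upper_banach_density_pos_if_syndetic)
qed

text \<open>The Fourier coefficients of the orbit segment of length \<open>N\<close>; \<open>z\<close> is
  an \<open>N\<close>-th root of unity when the segment is to be recovered from them.\<close>

definition fourier :: "nat \<Rightarrow> 'a \<Rightarrow> complex \<Rightarrow> 'a" where
  "fourier N x z = scl (1 / of_nat N) (\<Sum>k<N. scl (cnj z ^ k) ((T ^^ k) x))"

lemma fourier_mem: "x \<in> X \<Longrightarrow> fourier N x z \<in> X"
  unfolding fourier_def by (intro scale_mem sum_mem pow_mem)

text \<open>Applying \<open>T\<close> shifts the summation index by one, as does multiplication by
  \<open>z\<close>, so that only the two boundary terms remain.\<close>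

lemma fourier_approx_eigenvector:
  assumes x: "x \<in> X" and N: "N > 0" and z: "cmod z = 1" and K: "\<And>n. nrm ((T ^^ n) x) \<le> K"
  shows "nrm (T (fourier N x z) - scl z (fourier N x z)) \<le> 2 * K / N"
proof -
  define b where "b k = scl (z * cnj z ^ k) ((T ^^ k) x)" for k
  have b: "b k \<in> X" "nrm (b k) \<le> K" for k
    using x z K by (auto simp: b_def pow_mem scale_mem nrm_scale norm_mult norm_power)
  have shift: "z * cnj z ^ Suc k = cnj z ^ k" for k
    using unimodular_mult_cnj[OF z] by (simp flip: mult.assoc)
  have "T (fourier N x z) = scl (1 / of_nat N) (\<Sum>k<N. scl (cnj z ^ k) ((T ^^ Suc k) x))"
    unfolding fourier_def
    by (simp add: T_scale T_sum sum_mem scale_mem pow_mem x)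
  also have "\<dots> = scl (1 / of_nat N) (\<Sum>k<N. b (Suc k))"
    unfolding b_def shift ..
  finally have 1: "T (fourier N x z) = scl (1 / of_nat N) (\<Sum>k<N. b (Suc k))" .
  have 2: "scl z (fourier N x z) = scl (1 / of_nat N) (\<Sum>k<N. b k)"
    by (simp add: fourier_def b_def scale_sum_right mult_ac)
  have "T (fourier N x z) - scl z (fourier N x z) = scl (1 / of_nat N) (\<Sum>k<N. b (Suc k) - b k)"
    unfolding 1 2 by (simp add: sum_subtractf scale_right_diff_distrib)
  also have "(\<Sum>k<N. b (Suc k) - b k) = b N - b 0"
    by (rule sum_lessThan_telescope)
  also have "nrm (scl (1 / of_nat N) (b N - b 0)) = nrm (b N - b 0) / N"
    using b by (simp add: nrm_scale diff_mem norm_divide)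
  also have "nrm (b N - b 0) \<le> 2 * K"
    using nrm_triangle_diff[of "b N" "b 0"] b[of N] b[of 0] by linarith
  finally show ?thesis using N by (simp add: divide_right_mono)
qed

end

section \<open>Hilbert spaces: minimal norms and orthogonality\<close>

context complex_hilbert_space
begin

lemma ip_add_right: "x \<in> X \<Longrightarrow> y \<in> X \<Longrightarrow> z \<in> X \<Longrightarrow> ip x (y + z) = ip x y + ip x z"
  by (metis add_mem complex_cnj_add ip_add ip_cnj)

lemma ip_scale_right: "x \<in> X \<Longrightarrow> y \<in> X \<Longrightarrow> ip x (scl c y) = cnj c * ip x y"
  by (metis complex_cnj_mult ip_cnj ip_scale scale_mem)

lemma ip_diff: "x \<in> X \<Longrightarrow> y \<in> X \<Longrightarrow> z \<in> X \<Longrightarrow> ip (x - y) z = ip x z - ip y z"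
  by (metis diff_add_cancel diff_mem eq_diff_eq ip_add)

lemma ip_diff_right: "x \<in> X \<Longrightarrow> y \<in> X \<Longrightarrow> z \<in> X \<Longrightarrow> ip x (y - z) = ip x y - ip x z"
  by (metis diff_add_cancel diff_mem eq_diff_eq ip_add_right)

lemma ip_zero [simp]: "y \<in> X \<Longrightarrow> ip 0 y = 0"
  using ip_add[of 0 0 y] zero_mem by simp

lemma ip_sum: "(\<And>i. i \<in> J \<Longrightarrow> f i \<in> X) \<Longrightarrow> y \<in> X \<Longrightarrow> ip (sum f J) y = (\<Sum>i\<in>J. ip (f i) y)"
proof (induction J rule: infinite_finite_induct)
  case (insert j J)
  then have "ip (f j + sum f J) y = ip (f j) y + ip (sum f J) y"
    by (intro ip_add sum_mem) auto
  with insert show ?case by simp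
qed simp_all

lemma ip_sum_right: "(\<And>i. i \<in> J \<Longrightarrow> f i \<in> X) \<Longrightarrow> y \<in> X \<Longrightarrow> ip y (sum f J) = (\<Sum>i\<in>J. ip y (f i))"
  by (subst ip_cnj[of "sum f J"])
    (auto intro!: sum_mem sum.cong simp: ip_sum cnj_sum ip_cnj[of y])

lemma nrm_square_diff:
  assumes "x \<in> X" "y \<in> X"
  shows "(nrm (x - y))\<^sup>2 = (nrm x)\<^sup>2 + (nrm y)\<^sup>2 - 2 * Re (ip x y)"
proof -
  have "complex_of_real ((nrm (x - y))\<^sup>2) = ip (x - y) (x - y)"
    using assms by (simp add: ip_nrm diff_mem)
  also have "\<dots> = ip x x + ip y y - (ip x y + cnj (ip x y))"
    using assms by (simp add: ip_diff ip_diff_right diff_mem flip: ip_cnj)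
  also have "\<dots> = of_real ((nrm x)\<^sup>2 + (nrm y)\<^sup>2 - 2 * Re (ip x y))"
    using assms by (simp add: ip_nrm complex_add_cnj)
  finally show ?thesis by (simp only: of_real_eq_iff)
qed

lemma nrm_square_add:
  assumes "x \<in> X" "y \<in> X"
  shows "(nrm (x + y))\<^sup>2 = (nrm x)\<^sup>2 + (nrm y)\<^sup>2 + 2 * Re (ip x y)"
proof -
  have "x - scl (-1) y = x + y" by simp
  then show ?thesis
    using nrm_square_diff[of x "scl (-1) y"] assms scale_mem[OF assms(2), of "-1"]
      ip_scale_right[OF assms, of "-1"] nrm_minus[OF assms(2)]
    by simp
qed

lemma parallelogram_law:
  "x \<in> X \<Longrightarrow> y \<in> X \<Longrightarrow> (nrm (x - y))\<^sup>2 = 2 * (nrm x)\<^sup>2 + 2 * (nrm y)\<^sup>2 - (nrm (x + y))\<^sup>2"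
  by (simp add: nrm_square_diff nrm_square_add)

lemma nrm_minus_projection:
  assumes "y \<in> X" "z \<in> X" "z \<noteq> 0"
  shows "(nrm (y - scl (ip y z / (nrm z)\<^sup>2) z))\<^sup>2 = (nrm y)\<^sup>2 - (cmod (ip y z))\<^sup>2 / (nrm z)\<^sup>2"
proof -
  have z: "nrm z \<noteq> 0" using assms nrm_eq_0 by simp
  have "ip y (scl (ip y z / (nrm z)\<^sup>2) z) = cnj (ip y z) * ip y z / (nrm z)\<^sup>2"
    using assms by (simp add: ip_scale_right)
  also have "\<dots> = of_real ((cmod (ip y z))\<^sup>2 / (nrm z)\<^sup>2)"
    by (simp only: of_real_divide complex_norm_square mult.commute)
  finally have "Re (ip y (scl (ip y z / (nrm z)\<^sup>2) z)) = (cmod (ip y z))\<^sup>2 / (nrm z)\<^sup>2"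
    by (simp only: Re_complex_of_real)
  moreover have "nrm (scl (ip y z / (nrm z)\<^sup>2) z) = cmod (ip y z) / nrm z"
    using z assms(2) by (simp add: nrm_scale norm_divide norm_mult power2_eq_square)
  ultimately show ?thesis
    using assms by (subst nrm_square_diff) (auto simp: scale_mem power_divide)
qed

lemma Cauchy_Schwarz:
  assumes "x \<in> X" "y \<in> X"
  shows "cmod (ip x y) \<le> nrm x * nrm y"
proof (cases "y = 0")
  case True
  then show ?thesis using assms ip_cnj[of 0 x] zero_mem by simp
next
  case False
  then have y: "nrm y > 0" using assms nrm_eq_0 nrm_nonneg by (metis order_le_less)
  have "0 \<le> (nrm x)\<^sup>2 - (cmod (ip x y))\<^sup>2 / (nrm y)\<^sup>2"
    using nrm_minus_projection[OF assms False] by (metis zero_le_power2)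
  then have "(cmod (ip x y))\<^sup>2 \<le> (nrm x * nrm y)\<^sup>2"
    using y by (simp add: field_simps power_mult_distrib)
  then show ?thesis
    using y assms nrm_nonneg by (auto intro: power2_le_imp_le)
qed

text \<open>This replaces weak compactness of balls. Near-minimal elements of the sets \<open>C n\<close>
  form a Cauchy sequence by the parallelogram law, because the minimal norms increase to a
  finite limit \<open>D\<close> and midpoints stay in the sets. For constant \<open>C\<close> it
  yields the element of minimal norm of a closed convex set.\<close>

lemma nested_convex_closed_Inter:
  fixes C :: "nat \<Rightarrow> 'a set"
  assumes CX: "\<And>n. C n \<subseteq> X" and decr: "\<And>m n. m \<le> n \<Longrightarrow> C n \<subseteq> C m"
    and mid: "\<And>n u v. u \<in> C n \<Longrightarrow> v \<in> C n \<Longrightarrow> scl (1/2) (u + v) \<in> C n"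
    and closed: "\<And>n \<sigma> v. (\<And>k. \<sigma> k \<in> C n) \<Longrightarrow> v \<in> X \<Longrightarrow> (\<lambda>k. nrm (\<sigma> k - v)) \<longlonglongrightarrow> 0 \<Longrightarrow> v \<in> C n"
    and bdd: "\<And>n. \<exists>v\<in>C n. nrm v \<le> B"
  shows "\<exists>v. (\<forall>n. v \<in> C n) \<and> (\<forall>w. (\<forall>n. w \<in> C n) \<longrightarrow> nrm v \<le> nrm w)"
proof -
  define d where "d n = Inf (nrm ` C n)" for n
  have ne: "nrm ` C n \<noteq> {}" for n using bdd[of n] by auto
  have bb: "bdd_below (nrm ` C n)" for n
    using CX nrm_nonneg by (intro bdd_belowI[of _ 0]) auto
  have d_le: "d n \<le> nrm w" if "w \<in> C n" for n w
    unfolding d_def using that bb by (intro cInf_lower) auto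
  have d0: "0 \<le> d n" for n
    unfolding d_def using ne CX nrm_nonneg by (intro cInf_greatest) auto
  have dB: "d n \<le> B" for n using bdd[of n] d_le by (meson order_trans)
  have inc: "incseq d"
    unfolding d_def using ne bb decr by (intro monoI cInf_superset_mono image_mono) auto
  then obtain D where D: "d \<longlonglongrightarrow> D"
    using dB incseq_convergent[of d B] by blast
  have dD: "d n \<le> D" for n using incseq_le[OF inc D] .
  have "\<exists>v\<in>C n. nrm v < d n + 1 / (real n + 1)" for n
  proof -
    have "Inf (nrm ` C n) < d n + 1 / (real n + 1)" by (simp add: d_def)
    then show ?thesis using cInf_lessD[OF ne] by blast
  qed
  then obtain \<sigma> where \<sigma>: "\<And>n. \<sigma> n \<in> C n" "\<And>n. nrm (\<sigma> n) < d n + 1 / (real n + 1)"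
    by metis
  have \<sigma>X: "\<sigma> n \<in> X" for n using \<sigma> CX by auto
  have close: "(nrm (\<sigma> m - \<sigma> n))\<^sup>2 \<le> 4 * ((D + 1 / (real m + 1))\<^sup>2 - (d m)\<^sup>2)" if "m \<le> n" for m n
  proof -
    have le: "nrm (\<sigma> k) \<le> D + 1 / (real m + 1)" if "m \<le> k" for k
    proof -
      have "1 / (real k + 1) \<le> 1 / (real m + 1)" using that by (simp add: frac_le)
      then show ?thesis using \<sigma>(2)[of k] dD[of k] by linarith
    qed
    have sq: "(nrm (\<sigma> k))\<^sup>2 \<le> (D + 1 / (real m + 1))\<^sup>2" if "m \<le> k" for k
      using le[OF that] nrm_nonneg[OF \<sigma>X] by (rule power_mono)
    \<comment> \<open>The midpoint lies in \<open>C m\<close>, which bounds the last term of the parallelogram law from below.\<close>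
    have "\<sigma> n \<in> C m" using \<sigma>(1) decr[OF that] by auto
    then have "d m \<le> nrm (scl (1/2) (\<sigma> m + \<sigma> n))"
      using \<sigma>(1) by (intro d_le mid) auto
    then have "2 * d m \<le> nrm (\<sigma> m + \<sigma> n)"
      using \<sigma>X by (simp add: nrm_scale add_mem norm_divide)
    then have "(2 * d m)\<^sup>2 \<le> (nrm (\<sigma> m + \<sigma> n))\<^sup>2"
      using d0[of m] by (intro power_mono) auto
    then show ?thesis
      using sq[of m] sq[of n] that parallelogram_law[OF \<sigma>X \<sigma>X, of m n] by (simp add: power_mult_distrib)
  qed
  have lim0: "(\<lambda>m. 1 / (real m + 1)) \<longlonglongrightarrow> 0"
    using LIMSEQ_inverse_real_of_nat by (simp add: inverse_eq_divide add.commute)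
  have "(\<lambda>m. 4 * ((D + 1 / (real m + 1))\<^sup>2 - (d m)\<^sup>2)) \<longlonglongrightarrow> 4 * ((D + 0)\<^sup>2 - D\<^sup>2)"
    by (intro tendsto_intros D lim0)
  then have lim: "(\<lambda>m. 4 * ((D + 1 / (real m + 1))\<^sup>2 - (d m)\<^sup>2)) \<longlonglongrightarrow> 0" by simp
  have "MCauchy \<sigma>"
    unfolding MCauchy_iff_nrm
  proof (intro conjI allI impI)
    show "range \<sigma> \<subseteq> X" using \<sigma>X by auto
    fix e :: real assume e: "e > 0"
    then have "\<forall>\<^sub>F m in sequentially. 4 * ((D + 1 / (real m + 1))\<^sup>2 - (d m)\<^sup>2) < (e/2)\<^sup>2"
      by (intro order_tendstoD(2)[OF lim]) simp
    then obtain m where m: "4 * ((D + 1 / (real m + 1))\<^sup>2 - (d m)\<^sup>2) < (e/2)\<^sup>2"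
      by (auto simp: eventually_sequentially)
    have near: "nrm (\<sigma> m - \<sigma> k) < e/2" if "k \<ge> m" for k
      using close[OF that] m e by (intro power2_less_imp_less[of _ "e/2"]) auto
    have "nrm (\<sigma> j - \<sigma> k) < e" if "j \<ge> m" "k \<ge> m" for j k
      using near[OF that(1)] near[OF that(2)] nrm_diff_triangle[OF \<sigma>X \<sigma>X \<sigma>X, of j k m]
        nrm_commute[OF \<sigma>X \<sigma>X, of j m] by linarith
    then show "\<exists>n0. \<forall>j\<ge>n0. \<forall>k\<ge>n0. nrm (\<sigma> j - \<sigma> k) < e" by blast
  qed
  then obtain v where v: "v \<in> X" "(\<lambda>n. nrm (\<sigma> n - v)) \<longlonglongrightarrow> 0"
    by (rule nrm_Cauchy_convergent)
  have "v \<in> C n" for n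
  proof (rule closed)
    show "\<sigma> (k + n) \<in> C n" for k
      using \<sigma>(1)[of "k + n"] decr[of n "k + n"] by auto
    show "(\<lambda>k. nrm (\<sigma> (k + n) - v)) \<longlonglongrightarrow> 0"
      using v(2) by (rule LIMSEQ_ignore_initial_segment)
  qed (rule v)
  moreover have "nrm v \<le> nrm w" if "\<And>n. w \<in> C n" for w
  proof -
    have "(\<lambda>n. (d n + 1 / (real n + 1)) + nrm (\<sigma> n - v)) \<longlonglongrightarrow> (D + 0) + 0"
      by (intro tendsto_intros D lim0 v)
    moreover have "nrm v \<le> (d n + 1 / (real n + 1)) + nrm (\<sigma> n - v)" for n
      using nrm_le_add[OF v(1) \<sigma>X, of n] \<sigma>(2)[of n] nrm_commute[OF v(1) \<sigma>X, of n] by linarith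
    ultimately have "nrm v \<le> (D + 0) + 0"
      by (intro LIMSEQ_le_const) auto
    moreover have "D \<le> nrm w"
      using D d_le that by (intro LIMSEQ_le_const2) auto
    ultimately show ?thesis by simp
  qed
  ultimately show ?thesis by blast
qed

text \<open>The vector \<open>y\<close> is the component of \<open>x\<close> orthogonal to the closure of
  \<open>S\<close>: the element of minimal norm of the coset of \<open>x\<close>.\<close>

lemma separating_functional:
  assumes S: "subspace S" "S \<subseteq> X" and x: "x \<in> X" "x \<notin> nrm_closure X nrm S"
  obtains y where "y \<in> X" "\<And>z. z \<in> S \<Longrightarrow> ip z y = 0" "ip x y \<noteq> 0"
proof -
  let ?M = "nrm_closure X nrm S"
  have M: "subspace ?M" by (rule subspace_nrm_closure[OF S])
  have MX: "?M \<subseteq> X" by (rule nrm_closure_subset)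
  let ?C = "{v \<in> X. x - v \<in> ?M}"
  have mid: "scl (1/2) (u + v) \<in> ?C" if "u \<in> ?C" "v \<in> ?C" for u v
  proof -
    have "scl (1/2) x + scl (1/2) x = x"
      by (simp flip: scale_left_distrib)
    then have "x - scl (1/2) (u + v) = scl (1/2) (x - u) + scl (1/2) (x - v)"
      by (simp add: algebra_simps)
    then show ?thesis
      using that M by (simp add: scale_mem add_mem subspace_add subspace_scale)
  qed
  have cl: "v \<in> ?C" if s: "\<And>k. \<sigma> k \<in> ?C" and v: "v \<in> X" "(\<lambda>k. nrm (\<sigma> k - v)) \<longlonglongrightarrow> 0" for \<sigma> v
  proof -
    have "\<exists>a\<in>?M. nrm (x - v - a) < e" if e: "e > 0" for e
    proof -
      have "\<forall>\<^sub>F k in sequentially. nrm (\<sigma> k - v) < e"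
        using order_tendstoD(2)[OF v(2) e] .
      then obtain k where "nrm (\<sigma> k - v) < e" by (auto simp: eventually_sequentially)
      then show ?thesis using s[of k] by (intro bexI[of _ "x - \<sigma> k"]) auto
    qed
    then have "x - v \<in> nrm_closure X nrm ?M"
      unfolding mem_nrm_closure_iff[OF MX] using x v diff_mem by auto
    then show ?thesis
      using v nrm_closure_minimal[of ?M S] by auto
  qed
  have "\<exists>y. (\<forall>n::nat. y \<in> ?C) \<and> (\<forall>w. (\<forall>n::nat. w \<in> ?C) \<longrightarrow> nrm y \<le> nrm w)"
  proof (rule nested_convex_closed_Inter[of "\<lambda>_. ?C" "nrm x"])
    show "\<exists>v\<in>?C. nrm v \<le> nrm x" for n :: nat
      using x subspace_0[OF M] by (intro bexI[of _ x]) auto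
    show "scl (1/2) (u + v) \<in> ?C" if "u \<in> ?C" "v \<in> ?C" for n :: nat and u v
      using that by (rule mid)
    show "v \<in> ?C" if "\<And>k. \<sigma> k \<in> ?C" "v \<in> X" "(\<lambda>k. nrm (\<sigma> k - v)) \<longlonglongrightarrow> 0" for n :: nat and \<sigma> v
      using that by (rule cl)
  qed auto
  then obtain y where y: "y \<in> ?C" "\<And>w. w \<in> ?C \<Longrightarrow> nrm y \<le> nrm w" by auto
  have orth: "ip y z = 0" if z: "z \<in> ?M" for z
  proof (cases "z = 0")
    case True
    then show ?thesis using y ip_cnj[of 0 y] zero_mem by simp
  next
    case False
    have zX: "z \<in> X" using z MX by auto
    let ?w = "y - scl (ip y z / (nrm z)\<^sup>2) z"
    have "x - ?w = (x - y) + scl (ip y z / (nrm z)\<^sup>2) z" by simp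
    also have "\<dots> \<in> ?M"
      using y(1) z M by (intro subspace_add subspace_scale) auto
    finally have "?w \<in> ?C"
      using y(1) zX by (auto intro: diff_mem scale_mem)
    then have "nrm y \<le> nrm ?w" by (rule y(2))
    then have "(nrm y)\<^sup>2 \<le> (nrm ?w)\<^sup>2"
      using y nrm_nonneg by (intro power_mono) auto
    then have "(cmod (ip y z))\<^sup>2 / (nrm z)\<^sup>2 \<le> 0"
      using nrm_minus_projection[of y z] y zX False by simp
    then show ?thesis
      using False zX nrm_eq_0 by (simp add: divide_le_0_iff)
  qed
  have y0: "y \<noteq> 0" using y(1) x(2) by auto
  show ?thesis
  proof
    show yX: "y \<in> X" using y by simp
    show "ip z y = 0" if "z \<in> S" for z
    proof -
      have "z \<in> ?M" using that subset_nrm_closure[OF S(2)] by auto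
      then show ?thesis using orth[of z] ip_cnj[of y z] yX MX by auto
    qed
    have "ip (x - y) y = cnj (ip y (x - y))"
      using x yX by (intro ip_cnj diff_mem)
    then have "ip x y = ip y y"
      using orth[of "x - y"] y x by (simp add: ip_diff)
    then show "ip x y \<noteq> 0"
      using y0 yX nrm_eq_0 by (simp add: ip_nrm)
  qed
qed

end

section \<open>Reiteratively recurrent vectors in Hilbert spaces\<close>

locale operator_on_hilbert_space = complex_hilbert_space scl X nrm ip + operator_on_space scl X nrm T
  for scl :: "complex \<Rightarrow> 'a::ab_group_add \<Rightarrow> 'a" and X nrm ip T
begin

text \<open>If no \<open>W\<close> works, there are normalised vectors \<open>v n\<close> of bounded norm
  with \<open>ip (v n) y = 1\<close> that are more and more exact eigenvectors for unimodular
  \<open>\<mu> n\<close>. Along a subsequence \<open>\<mu> n\<close> tends to some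
  \<open>l\<close>, and the closed convex sets of approximate eigenvectors for \<open>l\<close>
  with \<open>ip w y = 1\<close> then have a common point: an eigenvector not orthogonal to
  \<open>y\<close>.\<close>

lemma orthogonality_estimate_from_eigenvectors:
  assumes y: "y \<in> X" and orth: "\<And>v. v \<in> E \<Longrightarrow> ip v y = 0" and e: "e > 0"
  obtains W where "W > 0"
    "\<And>\<mu> v. cmod \<mu> = 1 \<Longrightarrow> v \<in> X \<Longrightarrow> cmod (ip v y) \<le> e * nrm v + W * nrm (T v - scl \<mu> v)"
proof (rule ccontr)
  assume neg: "\<not> thesis"
  have "\<exists>\<mu> v. cmod \<mu> = 1 \<and> v \<in> X \<and> ip v y = 1 \<and> nrm v \<le> 1 / e
      \<and> nrm (T v - scl \<mu> v) \<le> 1 / (real n + 1)" for n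
  proof -
    have "\<exists>\<mu> v. cmod \<mu> = 1 \<and> v \<in> X \<and> cmod (ip v y) > e * nrm v + (real n + 1) * nrm (T v - scl \<mu> v)"
      using neg that[of "real n + 1"] by (meson not_le of_nat_0_le_iff add_nonneg_pos zero_less_one)
    then obtain \<mu> v where v: "cmod \<mu> = 1" "v \<in> X"
      "cmod (ip v y) > e * nrm v + (real n + 1) * nrm (T v - scl \<mu> v)" by blast
    have d: "T v - scl \<mu> v \<in> X" using v by (intro diff_mem T_mem scale_mem)
    have nn: "e * nrm v \<ge> 0" "(real n + 1) * nrm (T v - scl \<mu> v) \<ge> 0"
      using e v(2) d nrm_nonneg by simp_all
    then have pos: "cmod (ip v y) > 0" using v(3) by linarith
    let ?c = "1 / ip v y"
    have 1: "T (scl ?c v) - scl \<mu> (scl ?c v) = scl ?c (T v - scl \<mu> v)"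
      using v by (simp add: T_scale scale_right_diff_distrib mult.commute)
    have "nrm (scl ?c v) = nrm v / cmod (ip v y)"
      using v by (simp add: nrm_scale norm_divide)
    moreover have "nrm (scl ?c (T v - scl \<mu> v)) = nrm (T v - scl \<mu> v) / cmod (ip v y)"
      using d by (simp add: nrm_scale norm_divide)
    moreover have "nrm v / cmod (ip v y) \<le> 1 / e"
      using pos e nn v(3) by (simp add: field_simps)
    moreover have "nrm (T v - scl \<mu> v) / cmod (ip v y) \<le> 1 / (real n + 1)"
      using pos e nn v(3) by (simp add: field_simps)
    moreover have "ip (scl ?c v) y = 1"
      using pos v y by (simp add: ip_scale)
    ultimately show ?thesis
      using v 1 by (intro exI[of _ \<mu>] exI[of _ "scl ?c v"]) (auto simp: scale_mem)
  qed
  then obtain \<mu> v where \<mu>: "\<And>n. cmod (\<mu> n) = 1" and v: "\<And>n. v n \<in> X" "\<And>n. ip (v n) y = 1"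
    "\<And>n. nrm (v n) \<le> 1 / e" "\<And>n. nrm (T (v n) - scl (\<mu> n) (v n)) \<le> 1 / (real n + 1)"
    by metis
  have "seq_compact (sphere (0::complex) 1)"
    by (intro compact_imp_seq_compact compact_sphere)
  moreover have "\<forall>n. \<mu> n \<in> sphere 0 1" using \<mu> by simp
  ultimately obtain l r where l: "l \<in> sphere 0 1" "strict_mono r" "(\<mu> \<circ> r) \<longlonglongrightarrow> l"
    by (rule seq_compactE)
  define t where "t n = 1 / (real n + 1)" for n
  let ?C = "\<lambda>n. {w \<in> X. ip w y = 1 \<and> nrm (T w - scl l w) \<le> t n}"
  have tpos: "t n > 0" for n by (simp add: t_def)
  have "\<exists>w. (\<forall>n. w \<in> ?C n) \<and> (\<forall>w'. (\<forall>n. w' \<in> ?C n) \<longrightarrow> nrm w \<le> nrm w')"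
  proof (rule nested_convex_closed_Inter[of ?C "1 / e"])
    show "?C n \<subseteq> ?C m" if "m \<le> n" for m n
    proof -
      have "t n \<le> t m" using that by (simp add: t_def frac_le)
      then show ?thesis by auto
    qed
    show "scl (1/2) (u + v) \<in> ?C n" if "u \<in> ?C n" "v \<in> ?C n" for n u v
    proof -
      let ?D = "\<lambda>u. T u - scl l u"
      have X: "?D u \<in> X" "?D v \<in> X" "u \<in> X" "v \<in> X" using that by (auto intro: diff_mem T_mem scale_mem)
      have "?D (scl (1/2) (u + v)) = scl (1/2) (?D u + ?D v)"
      proof -
        have "T (scl (1/2) (u + v)) = scl (1/2) (T u + T v)"
          using X by (simp only: T_scale T_add add_mem)
        then show ?thesis by (simp add: algebra_simps)
      qed
      then have "nrm (?D (scl (1/2) (u + v))) \<le> 1/2 * (nrm (?D u) + nrm (?D v))"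
        using X nrm_triangle[of "?D u" "?D v"] by (simp add: nrm_scale add_mem norm_divide)
      also have "1/2 * (nrm (?D u) + nrm (?D v)) \<le> t n" using that by auto
      finally have "nrm (?D (scl (1/2) (u + v))) \<le> t n" .
      moreover have "ip (scl (1/2) (u + v)) y = 1"
        using that X y by (simp add: ip_scale ip_add add_mem)
      ultimately show ?thesis using X by (auto intro: scale_mem add_mem)
    qed
    show "u \<in> ?C n" if s: "\<And>k. \<sigma> k \<in> ?C n" and u: "u \<in> X" "(\<lambda>k. nrm (\<sigma> k - u)) \<longlonglongrightarrow> 0" for n \<sigma> u
    proof -
      let ?D = "\<lambda>u. T u - scl l u"
      obtain K where K: "K > 0" "\<And>x. x \<in> X \<Longrightarrow> nrm (T x) \<le> K * nrm x" using T_bound by blast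
      have \<sigma>X: "\<sigma> k \<in> X" for k using s by auto
      have DX: "?D x \<in> X" if "x \<in> X" for x using that by (intro diff_mem T_mem scale_mem)
      have dX: "\<sigma> k - u \<in> X" for k using \<sigma>X u by (intro diff_mem)
      have "nrm (?D u) \<le> t n + (K + 1) * nrm (\<sigma> k - u)" for k
      proof -
        have "?D (\<sigma> k) - ?D u = ?D (\<sigma> k - u)"
          using \<sigma>X u by (simp add: T_diff algebra_simps)
        moreover have "nrm (?D (\<sigma> k - u)) \<le> nrm (T (\<sigma> k - u)) + nrm (scl l (\<sigma> k - u))"
          using dX by (intro nrm_triangle_diff T_mem scale_mem)
        moreover have "nrm (scl l (\<sigma> k - u)) = nrm (\<sigma> k - u)"
          using l dX by (simp add: nrm_scale)
        moreover have "nrm (?D u) \<le> nrm (?D (\<sigma> k)) + nrm (?D u - ?D (\<sigma> k))"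
          using u \<sigma>X by (intro nrm_le_add DX)
        moreover have "nrm (?D u - ?D (\<sigma> k)) = nrm (?D (\<sigma> k) - ?D u)"
          using u \<sigma>X by (intro nrm_commute DX)
        moreover have "nrm (?D (\<sigma> k)) \<le> t n" using s[of k] by simp
        ultimately show ?thesis using K(2)[OF dX[of k]] by (simp add: algebra_simps)
      qed
      moreover have "(\<lambda>k. t n + (K + 1) * nrm (\<sigma> k - u)) \<longlonglongrightarrow> t n + (K + 1) * 0"
        by (intro tendsto_intros u)
      ultimately have "nrm (?D u) \<le> t n + (K + 1) * 0"
        by (intro LIMSEQ_le_const) auto
      moreover have "(\<lambda>k. nrm (\<sigma> k - u) * nrm y) \<longlonglongrightarrow> 0 * nrm y"
        by (intro tendsto_intros u)
      moreover have "cmod (1 - ip u y) \<le> nrm (\<sigma> k - u) * nrm y" for k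
        using Cauchy_Schwarz[OF dX y, of k] s[of k] u y by (simp add: ip_diff)
      ultimately have "nrm (?D u) \<le> t n" "cmod (1 - ip u y) \<le> 0 * nrm y"
        by (simp, intro LIMSEQ_le_const) auto
      then show ?thesis using u by simp
    qed
    show "\<exists>w\<in>?C n. nrm w \<le> 1 / e" for n
    proof -
      have "(\<lambda>k. t (r k) + cmod ((\<mu> \<circ> r) k - l) * (1 / e)) \<longlonglongrightarrow> 0 + cmod (l - l) * (1 / e)"
      proof (intro tendsto_intros l)
        have "t \<longlonglongrightarrow> 0" unfolding t_def
          using LIMSEQ_inverse_real_of_nat by (simp add: inverse_eq_divide add.commute)
        then show "(\<lambda>k. t (r k)) \<longlonglongrightarrow> 0"
          using l(2) LIMSEQ_subseq_LIMSEQ by (fastforce simp: o_def)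
      qed
      then have "\<forall>\<^sub>F k in sequentially. t (r k) + cmod ((\<mu> \<circ> r) k - l) * (1 / e) < t n"
        using tpos[of n] by (intro order_tendstoD(2)[of _ 0]) auto
      then obtain k where k: "t (r k) + cmod (\<mu> (r k) - l) * (1 / e) < t n"
        by (auto simp: eventually_sequentially)
      let ?v = "v (r k)"
      have "T ?v - scl l ?v = (T ?v - scl (\<mu> (r k)) ?v) + scl (\<mu> (r k) - l) ?v"
        by (simp add: scale_left_diff_distrib)
      also have "nrm \<dots> \<le> nrm (T ?v - scl (\<mu> (r k)) ?v) + nrm (scl (\<mu> (r k) - l) ?v)"
        using v(1) by (intro nrm_triangle diff_mem T_mem scale_mem)
      also have "\<dots> \<le> t (r k) + cmod (\<mu> (r k) - l) * (1 / e)"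
      proof (rule add_mono)
        show "nrm (scl (\<mu> (r k) - l) ?v) \<le> cmod (\<mu> (r k) - l) * (1 / e)"
          unfolding nrm_scale[OF v(1)] by (intro mult_left_mono v) simp
      qed (use v in \<open>simp add: t_def\<close>)
      finally show ?thesis using k v by (intro bexI[of _ ?v]) auto
    qed
  qed auto
  then obtain w where w: "\<And>n. w \<in> ?C n" by blast
  have "nrm (T w - scl l w) \<le> t n" for n using w[of n] by simp
  moreover have "t \<longlonglongrightarrow> 0" unfolding t_def
    using LIMSEQ_inverse_real_of_nat by (simp add: inverse_eq_divide add.commute)
  ultimately have "nrm (T w - scl l w) \<le> 0" by (intro LIMSEQ_le_const) auto
  moreover have wX: "w \<in> X" and wy: "ip w y = 1" using w[of 0] by auto
  moreover have "T w - scl l w \<in> X" using wX by (intro diff_mem T_mem scale_mem)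
  ultimately have "T w = scl l w" using nrm_eq_0 nrm_nonneg by (metis eq_iff_diff_eq_0 order_antisym)
  moreover have "w \<noteq> 0" using wy y by auto
  ultimately have "w \<in> E" using wX l by (auto simp: E_iff)
  then show False using orth wy by simp
qed

lemma fourier_Parseval_nrm:
  assumes x: "x \<in> X" and N: "N > 0"
  shows "(\<Sum>z | z ^ N = 1. (nrm (fourier N x z))\<^sup>2) = (\<Sum>k<N. (nrm ((T ^^ k) x))\<^sup>2) / N"
proof -
  let ?a = "\<lambda>k. (T ^^ k) x"
  have a: "?a k \<in> X" for k using x by (rule pow_mem)
  have "complex_of_real ((nrm (fourier N x z))\<^sup>2)
      = (\<Sum>j<N. \<Sum>k<N. cnj z ^ j * z ^ k * ip (?a j) (?a k)) / of_nat N ^ 2" for z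
  proof -
    have "complex_of_real ((nrm (fourier N x z))\<^sup>2) = ip (fourier N x z) (fourier N x z)"
      by (rule ip_nrm[symmetric]) (rule fourier_mem[OF x])
    also have "\<dots> = (\<Sum>j<N. \<Sum>k<N. cnj z ^ j * z ^ k * ip (?a j) (?a k)) / of_nat N ^ 2"
      proof -
      let ?s = "\<Sum>k<N. scl (cnj z ^ k) (?a k)"
      have s: "?s \<in> X" using a by (intro sum_mem scale_mem)
      have "ip ?s ?s = (\<Sum>j<N. \<Sum>k<N. cnj z ^ j * (z ^ k * ip (?a j) (?a k)))"
      proof -
        have "ip ?s ?s = (\<Sum>j<N. ip (scl (cnj z ^ j) (?a j)) ?s)"
          using a s by (intro ip_sum scale_mem)
        also have "\<dots> = (\<Sum>j<N. \<Sum>k<N. ip (scl (cnj z ^ j) (?a j)) (scl (cnj z ^ k) (?a k)))"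
          using a by (intro sum.cong refl ip_sum_right scale_mem)
        also have "\<dots> = (\<Sum>j<N. \<Sum>k<N. cnj z ^ j * (z ^ k * ip (?a j) (?a k)))"
          using a by (intro sum.cong refl) (simp add: ip_scale ip_scale_right scale_mem)
        finally show ?thesis .
      qed
      moreover have "ip (scl (1 / of_nat N) ?s) (scl (1 / of_nat N) ?s) = ip ?s ?s / of_nat N ^ 2"
        using s by (simp add: ip_scale ip_scale_right scale_mem power2_eq_square)
      ultimately show ?thesis by (simp add: fourier_def mult.assoc)
    qed
    finally show ?thesis .
  qed
  then have "complex_of_real (\<Sum>z | z ^ N = 1. (nrm (fourier N x z))\<^sup>2)
      = (of_nat N * (\<Sum>j<N. ip (?a j) (?a j))) / of_nat N ^ 2"
    by (simp add: roots_of_unity_Parseval flip: sum_divide_distrib)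
  also have "\<dots> = complex_of_real ((\<Sum>k<N. (nrm (?a k))\<^sup>2) / N)"
    using N a by (simp add: ip_nrm power2_eq_square)
  finally show ?thesis by (simp only: of_real_eq_iff)
qed

lemma fourier_Parseval_ip:
  assumes x: "x \<in> X" and N: "N > 0" and y: "y \<in> X"
  shows "(\<Sum>z | z ^ N = 1. (cmod (ip (fourier N x z) y))\<^sup>2) = (\<Sum>k<N. (cmod (ip ((T ^^ k) x) y))\<^sup>2) / N"
proof -
  let ?a = "\<lambda>k. ip ((T ^^ k) x) y"
  have a: "(T ^^ k) x \<in> X" for k using x by (rule pow_mem)
  have "complex_of_real ((cmod (ip (fourier N x z) y))\<^sup>2)
      = (\<Sum>j<N. \<Sum>k<N. cnj z ^ j * z ^ k * (?a j * cnj (?a k))) / of_nat N ^ 2" for z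
  proof -
    have "ip (fourier N x z) y = (\<Sum>j<N. cnj z ^ j * ?a j) / of_nat N"
      unfolding fourier_def using a y by (simp add: ip_scale ip_sum sum_mem scale_mem)
    moreover have "(\<Sum>j<N. cnj z ^ j * ?a j) * cnj (\<Sum>k<N. cnj z ^ k * ?a k)
        = (\<Sum>j<N. \<Sum>k<N. cnj z ^ j * z ^ k * (?a j * cnj (?a k)))"
      unfolding cnj_sum sum_product by (simp add: mult_ac)
    ultimately show ?thesis
      unfolding complex_norm_square by (simp add: power2_eq_square)
  qed
  then have "complex_of_real (\<Sum>z | z ^ N = 1. (cmod (ip (fourier N x z) y))\<^sup>2)
      = (of_nat N * (\<Sum>j<N. ?a j * cnj (?a j))) / of_nat N ^ 2"
    by (simp add: roots_of_unity_Parseval flip: sum_divide_distrib)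
  also have "\<dots> = complex_of_real ((\<Sum>k<N. (cmod (?a k))\<^sup>2) / N)"
    unfolding complex_norm_square[symmetric]
    using N by (simp add: power2_eq_square[of "of_nat N"])
  finally show ?thesis by (simp only: of_real_eq_iff)
qed

text \<open>The window \<open>{m..<m + N}\<close> may start anywhere, which is why positive upper Banach
  density of the return times is enough: the argument is applied to \<open>T ^^ m\<close> at
  \<open>x\<close>, whose orbit obeys the same bound.\<close>

theorem RRec_bo_subset_closure_span: "RRec_bo X nrm T \<subseteq> nrm_closure X nrm (span E)"
proof (rule subsetI, rule ccontr)
  fix x assume xR: "x \<in> RRec_bo X nrm T" and notin: "x \<notin> nrm_closure X nrm (span E)"
  obtain K0 where x: "x \<in> X" and K0: "\<And>n. nrm ((T ^^ n) x) \<le> K0"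
    using xR by (auto simp: RRec_bo_def)
  define K where "K = K0 + 1"
  have K: "K > 0" "\<And>n. nrm ((T ^^ n) x) \<le> K"
    using K0[of 0] nrm_nonneg[OF x] K0 unfolding K_def by (simp, meson add_increasing2 order_trans zero_le_one order_refl add_mono le_add_same_cancel1)
  obtain y where y: "y \<in> X" "\<And>z. z \<in> span E \<Longrightarrow> ip z y = 0" and xy: "ip x y \<noteq> 0"
    using separating_functional[OF subspace_span span_E_subset x notin] by blast
  define a where "a = cmod (ip x y) / 2"
  have a: "a > 0" using xy by (simp add: a_def)
  let ?U = "{z \<in> X. nrm (z - x) < a / (nrm y + 1)}"
  let ?A = "return_set T x ?U"
  have ny: "nrm y \<ge> 0" by (rule nrm_nonneg[OF y(1)])
  have "?U \<in> nrm_nhds X nrm x"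
    using a ny by (intro ball_in_nrm_nhds x) simp
  then have "upper_banach_density ?A > 0"
    using xR unfolding RRec_bo_def by blast
  then obtain d where d: "d > 0"
    "\<And>L0. \<exists>N\<ge>L0. \<exists>m. N > 0 \<and> d * real N \<le> real (card (?A \<inter> {m..<m + N}))"
    by (rule dense_windows_if_upper_banach_density_pos) blast
  have large: "a \<le> cmod (ip ((T ^^ n) x) y)" if "n \<in> ?A" for n
  proof -
    let ?z = "(T ^^ n) x"
    have z: "?z \<in> X" "nrm (?z - x) < a / (nrm y + 1)" using that by (auto simp: return_set_def)
    have "cmod (ip x y) - cmod (ip ?z y) \<le> cmod (ip ?z y - ip x y)"
      by (metis norm_minus_commute norm_triangle_ineq2)
    also have "\<dots> = cmod (ip (?z - x) y)" using z x y by (simp add: ip_diff)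
    also have "\<dots> \<le> nrm (?z - x) * nrm y" using z x y by (intro Cauchy_Schwarz diff_mem)
    also have "\<dots> \<le> (a / (nrm y + 1)) * (nrm y + 1)"
      using z(2) ny a by (intro mult_mono) auto
    also have "\<dots> = a" using ny by simp
    finally show ?thesis by (simp add: a_def)
  qed
  \<comment> \<open>Chosen such that the first term of the final estimate uses up half of the lower bound \<open>d * a\<^sup>2\<close>.\<close>
  define e where "e = a * sqrt d / (2 * K)"
  have e: "e > 0" using a d K by (simp add: e_def)
  have e2: "2 * e\<^sup>2 * K\<^sup>2 = d * a\<^sup>2 / 2"
    using d K by (simp add: e_def power_mult_distrib power_divide)
  obtain W where W: "W > 0"
    "\<And>\<mu> v. cmod \<mu> = 1 \<Longrightarrow> v \<in> X \<Longrightarrow> cmod (ip v y) \<le> e * nrm v + W * nrm (T v - scl \<mu> v)"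
    using orthogonality_estimate_from_eigenvectors[OF y(1) y(2)[OF span_base] e] by blast
  obtain L0 :: nat where L0: "real L0 > 16 * W\<^sup>2 * K\<^sup>2 / (d * a\<^sup>2)"
    using reals_Archimedean2 by blast
  obtain N m where N: "N \<ge> L0" "N > 0" and card: "d * real N \<le> real (card (?A \<inter> {m..<m + N}))"
    using d(2)[of L0] by blast
  define x' where "x' = (T ^^ m) x"
  have x': "x' \<in> X" using x by (simp add: x'_def pow_mem)
  have orb': "(T ^^ k) x' = (T ^^ (m + k)) x" for k
    by (simp add: x'_def funpow_add add.commute[of m])
  have K': "nrm ((T ^^ k) x') \<le> K" for k unfolding orb' by (rule K)
  have "d * a\<^sup>2 * N \<le> (\<Sum>k<N. (cmod (ip ((T ^^ k) x') y))\<^sup>2)"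
  proof -
    let ?J = "{k \<in> {..<N}. m + k \<in> ?A}"
    have "bij_betw (\<lambda>k. m + k) ?J (?A \<inter> {m..<m + N})"
      by (rule bij_betwI[where g = "\<lambda>n. n - m"]) auto
    then have "card ?J = card (?A \<inter> {m..<m + N})" by (rule bij_betw_same_card)
    then have "d * a\<^sup>2 * N \<le> (\<Sum>k\<in>?J. a\<^sup>2)"
      using mult_right_mono[OF card, of "a\<^sup>2"] by (simp add: mult_ac)
    also have "\<dots> \<le> (\<Sum>k\<in>?J. (cmod (ip ((T ^^ k) x') y))\<^sup>2)"
      using large a unfolding orb' by (intro sum_mono power_mono) auto
    also have "\<dots> \<le> (\<Sum>k<N. (cmod (ip ((T ^^ k) x') y))\<^sup>2)"
      by (intro sum_mono2) auto
    finally show ?thesis .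
  qed
  then have "d * a\<^sup>2 \<le> (\<Sum>z | z ^ N = 1. (cmod (ip (fourier N x' z) y))\<^sup>2)"
    using N by (simp add: fourier_Parseval_ip[OF x' _ y(1)] field_simps)
  also have "\<dots> \<le> (\<Sum>z | z ^ N = 1. 2 * e\<^sup>2 * (nrm (fourier N x' z))\<^sup>2 + 2 * W\<^sup>2 * (2 * K / N)\<^sup>2)"
  proof (rule sum_mono)
    fix z assume "z \<in> {z::complex. z ^ N = 1}"
    then have z: "cmod z = 1" using N unimodular_if_root_of_unity by auto
    let ?u = "fourier N x' z"
    have u: "?u \<in> X" by (rule fourier_mem[OF x'])
    have "cmod (ip ?u y) \<le> e * nrm ?u + W * nrm (T ?u - scl z ?u)"
      by (rule W(2)[OF z u])
    also have "\<dots> \<le> e * nrm ?u + W * (2 * K / N)"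
      using fourier_approx_eigenvector[OF x' N(2) z K'] W(1) by (intro add_left_mono mult_left_mono) auto
    finally have "(cmod (ip ?u y))\<^sup>2 \<le> (e * nrm ?u + W * (2 * K / N))\<^sup>2"
      by (intro power_mono) auto
    also have "\<dots> \<le> 2 * (e * nrm ?u)\<^sup>2 + 2 * (W * (2 * K / N))\<^sup>2"
      using sum_squares_bound[of "e * nrm ?u" "W * (2 * K / N)"] by (simp add: power2_sum)
    finally show "(cmod (ip ?u y))\<^sup>2 \<le> 2 * e\<^sup>2 * (nrm ?u)\<^sup>2 + 2 * W\<^sup>2 * (2 * K / N)\<^sup>2"
      by (simp only: power_mult_distrib mult.assoc)
  qed
  also have "\<dots> = 2 * e\<^sup>2 * ((\<Sum>k<N. (nrm ((T ^^ k) x'))\<^sup>2) / N) + N * (2 * W\<^sup>2 * (2 * K / N)\<^sup>2)"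
    unfolding fourier_Parseval_nrm[OF x' N(2), symmetric]
    using card_roots_unity_eq[OF N(2)] by (simp add: sum.distrib sum_distrib_left)
  also have "\<dots> \<le> 2 * e\<^sup>2 * K\<^sup>2 + N * (2 * W\<^sup>2 * (2 * K / N)\<^sup>2)"
  proof -
    have "(\<Sum>k<N. (nrm ((T ^^ k) x'))\<^sup>2) \<le> (\<Sum>k<N. K\<^sup>2)"
      using K' x' nrm_nonneg by (intro sum_mono power_mono) (auto intro: pow_mem)
    then have "(\<Sum>k<N. (nrm ((T ^^ k) x'))\<^sup>2) / N \<le> K\<^sup>2"
      using N by (simp add: field_simps)
    then show ?thesis by (intro add_right_mono mult_left_mono) auto
  qed
  also have "N * (2 * W\<^sup>2 * (2 * K / N)\<^sup>2) = 8 * W\<^sup>2 * K\<^sup>2 / N"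
    using N by (simp add: power2_eq_square field_simps)
  also have "\<dots> < d * a\<^sup>2 / 2"
  proof -
    have "16 * W\<^sup>2 * K\<^sup>2 / (d * a\<^sup>2) < real N" using L0 N by linarith
    then show ?thesis using N a d by (simp add: field_simps)
  qed
  finally show False using e2 by simp
qed

end

section \<open>Almost periodic orbits of power-bounded operators\<close>

text \<open>The centres of the covering balls need not lie in \<open>S\<close>, at the cost of a factor 2
  in the radius.\<close>

lemma (in Metric_space) mtotally_bounded_weakI:
  assumes S: "S \<subseteq> M" and K: "\<And>e. e > 0 \<Longrightarrow> \<exists>K. finite K \<and> S \<subseteq> (\<Union>x\<in>K. mball x e)"
  shows "mtotally_bounded S"
  unfolding mtotally_bounded_def
proof (intro allI impI)
  fix e :: real assume "e > 0"
  then obtain K where K: "finite K" "S \<subseteq> (\<Union>x\<in>K. mball x (e / 2))"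
    using assms(2)[of "e / 2"] by auto
  have "\<forall>y. \<exists>s. mball y (e / 2) \<inter> S \<noteq> {} \<longrightarrow> s \<in> mball y (e / 2) \<inter> S" by auto
  then obtain f where f: "\<And>y. mball y (e / 2) \<inter> S \<noteq> {} \<Longrightarrow> f y \<in> mball y (e / 2) \<inter> S" by metis
  let ?K = "f ` {y \<in> K. mball y (e / 2) \<inter> S \<noteq> {}}"
  have "S \<subseteq> (\<Union>x\<in>?K. mball x e)"
  proof
    fix s assume s: "s \<in> S"
    then obtain y where y: "y \<in> K" "s \<in> mball y (e / 2)" using K(2) by blast
    then have fy: "f y \<in> mball y (e / 2)" using f[of y] s by blast
    have "d (f y) s \<le> d y (f y) + d y s"
      using y fy triangle[of "f y" y s] commute[of y "f y"] by auto
    also have "\<dots> < e" using y fy by auto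
    finally have "s \<in> mball (f y) e" using y fy by auto
    moreover have "f y \<in> ?K" using y s by blast
    ultimately show "s \<in> (\<Union>x\<in>?K. mball x e)" by blast
  qed
  moreover have "finite ?K" "?K \<subseteq> S" using K(1) f by auto
  ultimately show "\<exists>K. finite K \<and> K \<subseteq> S \<and> S \<subseteq> (\<Union>x\<in>K. mball x e)" by blast
qed

locale power_bounded_on_banach_space = complex_banach_space scl X nrm + operator_on_space scl X nrm T
  for scl :: "complex \<Rightarrow> 'a::ab_group_add \<Rightarrow> 'a" and X nrm T +
  fixes C :: real
  assumes C_ge_1: "1 \<le> C" and pow_bound: "x \<in> X \<Longrightarrow> nrm ((T ^^ n) x) \<le> C * nrm x"
begin

lemma URec_returns_syndetic:
  assumes "x \<in> URec X nrm T" "e > 0"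
  shows "syndetic {n. nrm ((T ^^ n) x - x) < e}"
proof -
  have "x \<in> X" using assms by (simp add: URec_def)
  then have "syndetic (return_set T x {z \<in> X. nrm (z - x) < e})"
    using assms ball_in_nrm_nhds by (auto simp: URec_def)
  then show ?thesis
    by (rule syndetic_mono) (auto simp: return_set_def)
qed

text \<open>Write \<open>n\<close> as an almost period \<open>k\<close> plus a remainder at most the gap
  length; the powers of \<open>T\<close> move the almost return at time \<open>k\<close> by at
  most the factor \<open>C\<close>.\<close>

lemma orbit_totally_bounded:
  assumes x: "x \<in> URec X nrm T" and e: "e > 0"
  obtains m where "\<And>n. \<exists>r\<le>m. nrm ((T ^^ n) x - (T ^^ r) x) < e"
proof -
  have xX: "x \<in> X" using x by (simp add: URec_def)
  have "e / C > 0" using e C_ge_1 by simp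
  then obtain m where m: "\<And>p. {p..p + m} \<inter> {n. nrm ((T ^^ n) x - x) < e / C} \<noteq> {}"
    using URec_returns_syndetic[OF x] unfolding syndetic_def by meson
  have "\<exists>r\<le>m. nrm ((T ^^ n) x - (T ^^ r) x) < e" for n
  proof (cases "n \<le> m")
    case True
    then show ?thesis using e by (intro exI[of _ n]) auto
  next
    case False
    obtain k where k: "n - m \<le> k" "k \<le> n - m + m" "nrm ((T ^^ k) x - x) < e / C"
      using m[of "n - m"] by auto
    have "(T ^^ n) x = (T ^^ (n - k)) ((T ^^ k) x)"
      using k False by (simp flip: funpow_add comp_apply[of "T ^^ (n - k)" "T ^^ k" x])
    then have "(T ^^ n) x - (T ^^ (n - k)) x = (T ^^ (n - k)) ((T ^^ k) x - x)"
      using xX by (simp add: pow_diff pow_mem)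
    then have "nrm ((T ^^ n) x - (T ^^ (n - k)) x) \<le> C * nrm ((T ^^ k) x - x)"
      using pow_bound xX by (simp add: diff_mem pow_mem)
    also have "\<dots> < e" using k(3) C_ge_1 by (simp add: field_simps)
    finally show ?thesis using k False by (intro exI[of _ "n - k"]) auto
  qed
  then show ?thesis by (rule that)
qed

text \<open>Replacing each orbit point by a nearby one among the first \<open>m + 1\<close> turns a
  Fourier coefficient into a combination of \<open>m + 1\<close> fixed vectors with coefficients
  \<open>c r\<close> in the closed unit disc, and the disc has finite nets \<open>Z\<close>.\<close>

lemma fourier_totally_bounded:
  assumes x: "x \<in> URec X nrm T"
  shows "mtotally_bounded {fourier N x z |N z. N > 0 \<and> cmod z = 1}" (is "mtotally_bounded ?S")
proof (rule mtotally_bounded_weakI)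
  show "?S \<subseteq> X" using x by (auto simp: URec_def intro: fourier_mem)
  fix e :: real assume e: "e > 0"
  let ?a = "\<lambda>k. (T ^^ k) x"
  have xX: "x \<in> X" using x by (simp add: URec_def)
  have aX: "?a k \<in> X" for k using xX by (rule pow_mem)
  obtain m where m: "\<And>n. \<exists>r\<le>m. nrm (?a n - ?a r) < e / 2"
    using orbit_totally_bounded[OF x, of "e / 2"] e by (metis half_gt_zero)
  then obtain \<rho> where \<rho>: "\<And>n. \<rho> n \<le> m" "\<And>n. nrm (?a n - ?a (\<rho> n)) < e / 2" by metis
  define B where "B = (real m + 1) * (C * nrm x) + 1"
  have B: "B \<ge> 1" unfolding B_def using C_ge_1 nrm_nonneg[OF xX] by simp
  define d where "d = e / (2 * B)"
  have d: "d > 0" using e B by (simp add: d_def)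
  have "compact (cball (0::complex) 1)" by simp
  then obtain Z where Z: "finite Z" "cball (0::complex) 1 \<subseteq> (\<Union>z\<in>Z. ball z d)"
    using compactE_image[of "cball (0::complex) 1" "cball 0 1" "\<lambda>z. ball z d"] d
    by (metis (no_types, lifting) UN_I centre_in_ball open_ball subsetI)
  let ?K = "(\<lambda>g. \<Sum>r\<le>m. scl (g r) (?a r)) ` (PiE {..m} (\<lambda>_. Z))"
  have "finite ?K" using Z by (intro finite_imageI finite_PiE) auto
  moreover have "?S \<subseteq> (\<Union>y\<in>?K. mball y e)"
  proof
    fix u assume "u \<in> ?S"
    then obtain N z where u: "u = fourier N x z" and N: "N > 0" and z: "cmod z = 1" by auto
    define w where "w k = 1 / of_nat N * cnj z ^ k" for k
    have w: "cmod (w k) = 1 / N" for k using N z by (simp add: w_def norm_mult norm_power norm_divide)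
    have u_eq: "u = (\<Sum>k<N. scl (w k) (?a k))"
      by (simp add: u fourier_def w_def scale_sum_right)
    define c where "c r = (\<Sum>k | k < N \<and> \<rho> k = r. w k)" for r
    have "cmod (c r) \<le> 1" for r
    proof -
      have "cmod (c r) \<le> (\<Sum>k | k < N \<and> \<rho> k = r. cmod (w k))" unfolding c_def by (rule norm_sum)
      also have "\<dots> \<le> (\<Sum>k<N. cmod (w k))" by (intro sum_mono2) auto
      also have "\<dots> = 1" using N by (simp add: w)
      finally show ?thesis .
    qed
    then have "\<forall>r. \<exists>g. g \<in> Z \<and> cmod (c r - g) < d"
      using Z(2) by (fastforce simp: dist_norm norm_minus_commute)
    then obtain g where g: "\<And>r. g r \<in> Z" "\<And>r. cmod (c r - g r) < d" by metis
    let ?y = "\<Sum>r\<le>m. scl (g r) (?a r)"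
    have yX: "?y \<in> X" using aX by (intro sum_mem scale_mem)
    have mid: "(\<Sum>k<N. scl (w k) (?a (\<rho> k))) = (\<Sum>r\<le>m. scl (c r) (?a r))"
    proof -
      have "(\<Sum>k<N. scl (w k) (?a (\<rho> k))) = (\<Sum>r\<le>m. \<Sum>k | k \<in> {..<N} \<and> \<rho> k = r. scl (w k) (?a (\<rho> k)))"
        using \<rho>(1) by (intro sum.group[symmetric]) auto
      also have "\<dots> = (\<Sum>r\<le>m. scl (c r) (?a r))"
        unfolding c_def scale_sum_left by (intro sum.cong refl) auto
      finally show ?thesis .
    qed
    let ?v = "\<Sum>r\<le>m. scl (c r) (?a r)"
    have vX: "?v \<in> X" using aX by (intro sum_mem scale_mem)
    have uX: "u \<in> X" unfolding u by (rule fourier_mem[OF xX])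
    have "u - ?v = (\<Sum>k<N. scl (w k) (?a k - ?a (\<rho> k)))"
      unfolding u_eq mid[symmetric] by (simp add: scale_right_diff_distrib sum_subtractf)
    also have "nrm \<dots> \<le> (\<Sum>k<N. nrm (scl (w k) (?a k - ?a (\<rho> k))))"
      using aX by (intro nrm_sum_le scale_mem diff_mem)
    also have "\<dots> \<le> (\<Sum>k<N. 1 / N * (e / 2))"
    proof (rule sum_mono)
      fix k
      show "nrm (scl (w k) (?a k - ?a (\<rho> k))) \<le> 1 / N * (e / 2)"
        unfolding nrm_scale[OF diff_mem[OF aX aX]] w
        using \<rho>(2)[of k] by (intro mult_left_mono) auto
    qed
    also have "\<dots> = e / 2" using N by simp
    finally have 1: "nrm (u - ?v) \<le> e / 2" .
    have "?v - ?y = (\<Sum>r\<le>m. scl (c r - g r) (?a r))"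
      by (simp add: scale_left_diff_distrib sum_subtractf)
    also have "nrm \<dots> \<le> (\<Sum>r\<le>m. nrm (scl (c r - g r) (?a r)))"
      using aX by (intro nrm_sum_le scale_mem)
    also have "\<dots> \<le> (\<Sum>r\<le>m. d * (C * nrm x))"
    proof (rule sum_mono)
      fix r
      show "nrm (scl (c r - g r) (?a r)) \<le> d * (C * nrm x)"
        unfolding nrm_scale[OF aX]
        using g(2)[of r] d pow_bound[OF xX, of r] nrm_nonneg[OF aX] by (intro mult_mono) auto
    qed
    also have "\<dots> = d * (B - 1)" by (simp add: B_def algebra_simps)
    also have "\<dots> < e / 2"
      using e B by (simp add: d_def field_simps)
    finally have 2: "nrm (?v - ?y) < e / 2" .
    have "nrm (u - ?y) < e"
      using nrm_diff_triangle[OF uX vX yX] 1 2 by linarith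
    then have "u \<in> mball ?y e"
      using uX yX nrm_commute[OF uX yX] by (simp add: nrm_dist_def)
    moreover have "?y \<in> ?K"
      by (rule image_eqI[of _ _ "restrict g {..m}"]) (use g in auto)
    ultimately show "u \<in> (\<Union>y\<in>?K. mball y e)" by blast
  qed
  ultimately show "\<exists>K. finite K \<and> ?S \<subseteq> (\<Union>y\<in>K. mball y e)" by blast
qed

text \<open>The limit of a convergent sequence of Fourier coefficients for windows of growing length is an
  eigenvector or 0, by \<open>fourier_approx_eigenvector\<close>; total boundedness provides
  such sequences.\<close>

lemma fourier_near_span_E:
  assumes x: "x \<in> URec X nrm T" and e: "e > 0"
  obtains N0 where "\<And>N z. N \<ge> N0 \<Longrightarrow> N > 0 \<Longrightarrow> cmod z = 1 \<Longrightarrow> \<exists>v\<in>span E. nrm (fourier N x z - v) < e"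
proof (rule ccontr)
  assume neg: "\<not> thesis"
  have xX: "x \<in> X" using x by (simp add: URec_def)
  have "\<forall>n. \<exists>N z. N \<ge> n \<and> N > 0 \<and> cmod z = 1 \<and> \<not> (\<exists>v\<in>span E. nrm (fourier N x z - v) < e)"
    using neg that by meson
  then obtain N z where N: "\<And>n. N n \<ge> n" "\<And>n. N n > 0" and z: "\<And>n. cmod (z n) = 1"
    and far: "\<And>n v. v \<in> span E \<Longrightarrow> \<not> nrm (fourier (N n) x (z n) - v) < e" by metis
  define u where "u n = fourier (N n) x (z n)" for n
  have uX: "u n \<in> X" for n unfolding u_def by (rule fourier_mem[OF xX])
  have "range u \<subseteq> {fourier N x z |N z. N > 0 \<and> cmod z = 1}"
    using N z unfolding u_def by blast
  then obtain r where r: "strict_mono r" "MCauchy (u \<circ> r)"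
    using fourier_totally_bounded[OF x] unfolding mtotally_bounded_sequentially by blast
  obtain v where v: "v \<in> X" "(\<lambda>n. nrm ((u \<circ> r) n - v)) \<longlonglongrightarrow> 0"
    using nrm_Cauchy_convergent[OF r(2)] by blast
  have "seq_compact (sphere (0::complex) 1)"
    by (intro compact_imp_seq_compact compact_sphere)
  moreover have "\<forall>n. (z \<circ> r) n \<in> sphere 0 1" using z by simp
  ultimately obtain l s where l: "l \<in> sphere 0 1" "strict_mono s" "((z \<circ> r) \<circ> s) \<longlonglongrightarrow> l"
    by (rule seq_compactE)
  define q where "q = r \<circ> s"
  have q: "strict_mono q" using r(1) l(2) by (simp add: q_def strict_mono_o)
  have lim_u: "(\<lambda>n. nrm (u (q n) - v)) \<longlonglongrightarrow> 0"
    using LIMSEQ_subseq_LIMSEQ[OF v(2) l(2)] by (simp add: q_def o_def)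
  have lim_z: "(\<lambda>n. z (q n)) \<longlonglongrightarrow> l"
    using l(3) by (simp add: q_def o_def)
  obtain K where K: "K > 0" "\<And>x. x \<in> X \<Longrightarrow> nrm (T x) \<le> K * nrm x" using T_bound by blast
  define M where "M = C * nrm x"
  let ?b = "\<lambda>n. K * nrm (u (q n) - v) + 2 * M / real (N (q n)) + nrm (u (q n) - v)
    + cmod (z (q n) - l) * nrm v"
  have bound: "nrm (T v - scl l v) \<le> ?b n" for n
  proof -
    let ?u = "u (q n)" let ?z = "z (q n)"
    have X: "?u \<in> X" "v \<in> X" "v - ?u \<in> X" "?u - v \<in> X" using uX v by (auto intro: diff_mem)
    have "T v - scl l v = T (v - ?u) + (T ?u - scl ?z ?u) + scl ?z (?u - v) + scl (?z - l) v"
      using X by (simp add: T_diff algebra_simps)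
    also have "nrm \<dots> \<le> nrm (T (v - ?u)) + nrm (T ?u - scl ?z ?u) + nrm (scl ?z (?u - v)) + nrm (scl (?z - l) v)"
      using X by (intro order_trans[OF nrm_triangle] add_mono order_refl)
        (auto intro!: add_mem diff_mem scale_mem T_mem)
    also have "nrm (T (v - ?u)) \<le> K * nrm (?u - v)"
      using K(2)[OF X(3)] nrm_commute[OF X(1,2)] by simp
    also have "nrm (T ?u - scl ?z ?u) \<le> 2 * M / real (N (q n))"
      unfolding u_def using N z pow_bound xX by (intro fourier_approx_eigenvector) (auto simp: M_def)
    finally show ?thesis using X z by (simp add: nrm_scale)
  qed
  have "(\<lambda>n. 2 * M * inverse (real (N (q n)))) \<longlonglongrightarrow> 2 * M * 0"
  proof (intro tendsto_intros tendsto_inverse_0_at_top)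
    have "n \<le> N (q n)" for n using N(1)[of "q n"] seq_suble[OF q, of n] by linarith
    then show "filterlim (\<lambda>n. real (N (q n))) at_top sequentially"
      by (intro filterlim_at_top_mono[OF filterlim_real_sequentially]) auto
  qed
  then have "(\<lambda>n. 2 * M / real (N (q n))) \<longlonglongrightarrow> 0" by (simp add: divide_inverse)
  then have "?b \<longlonglongrightarrow> K * 0 + 0 + 0 + cmod (l - l) * nrm v"
    by (intro tendsto_intros lim_u lim_z)
  then have "nrm (T v - scl l v) \<le> K * 0 + 0 + 0 + cmod (l - l) * nrm v"
    by (rule LIMSEQ_le_const) (use bound in blast)
  moreover have "T v - scl l v \<in> X" using v by (intro diff_mem T_mem scale_mem)
  ultimately have "T v - scl l v = 0"
    using nrm_eq_0 nrm_nonneg by (metis order_antisym mult_zero_right add_0 diff_self norm_zero mult_zero_left)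
  then have "v \<in> span E" using v l by (intro eigenspace_subset_span[of v l]) auto
  moreover have "\<forall>\<^sub>F n in sequentially. nrm (u (q n) - v) < e"
    using order_tendstoD(2)[OF lim_u e] .
  then obtain n where "nrm (u (q n) - v) < e" by (auto simp: eventually_sequentially)
  ultimately show False using far[of v "q n"] by (simp add: u_def)
qed

text \<open>On the orbit of a uniformly recurrent vector the powers of \<open>T\<close> are bounded below
  by \<open>1 / C\<close>: a later almost return at time \<open>s\<close> nearly undoes \<open>T
  ^^ i\<close>, because it also moves \<open>(T ^^ p) x\<close> only a little.\<close>

lemma orbit_difference_bounded_below:
  assumes x: "x \<in> URec X nrm T"
  shows "nrm ((T ^^ p) x - x) \<le> C * nrm ((T ^^ (i + p)) x - (T ^^ i) x)"
proof (rule field_le_epsilon)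
  fix e :: real assume e: "e > 0"
  have xX: "x \<in> X" using x by (simp add: URec_def)
  have "e / (C + 1) > 0" using e C_ge_1 by simp
  then obtain s where s: "s \<ge> i" "nrm ((T ^^ s) x - x) < e / (C + 1)"
    using URec_returns_syndetic[OF x] unfolding syndetic_def by fastforce
  let ?z = "(T ^^ p) x - x" let ?y = "(T ^^ s) x - x"
  have X: "?z \<in> X" "?y \<in> X" "(T ^^ s) ?z \<in> X" "(T ^^ i) ?z \<in> X" "(T ^^ p) ?y \<in> X"
    using xX by (auto intro: diff_mem pow_mem)
  have "(T ^^ s) ?z = (T ^^ (s - i)) ((T ^^ i) ?z)"
    using s by (simp flip: funpow_add comp_apply[of "T ^^ (s - i)" "T ^^ i" ?z])
  then have 1: "nrm ((T ^^ s) ?z) \<le> C * nrm ((T ^^ i) ?z)"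
    using pow_bound[OF X(4), of "s - i"] by simp
  have comm: "(T ^^ s) ((T ^^ p) x) = (T ^^ p) ((T ^^ s) x)"
    by (metis add.commute comp_apply funpow_add)
  have "?z - (T ^^ s) ?z = ?y - (T ^^ p) ?y"
    using xX by (simp add: pow_diff pow_mem comm)
  then have "nrm (?z - (T ^^ s) ?z) = nrm (?y - (T ^^ p) ?y)" by (simp only:)
  also have "\<dots> \<le> nrm ?y + nrm ((T ^^ p) ?y)"
    using X by (intro nrm_triangle_diff)
  also have "\<dots> \<le> (C + 1) * nrm ?y"
    using pow_bound[OF X(2), of p] by (simp add: algebra_simps)
  also have "\<dots> < e" using s(2) C_ge_1 by (simp add: field_simps)
  finally have "nrm ?z \<le> C * nrm ((T ^^ i) ?z) + e"
    using nrm_le_add[OF X(1,3)] 1 by linarith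
  moreover have "(T ^^ i) ?z = (T ^^ (i + p)) x - (T ^^ i) x"
    using xX by (simp add: pow_diff pow_mem funpow_add)
  ultimately show "nrm ?z \<le> C * nrm ((T ^^ (i + p)) x - (T ^^ i) x) + e" by simp
qed

text \<open>If \<open>i \<le> j\<close>, the exponent is \<open>j - i\<close>. Otherwise it is \<open>N -
  (i - j)\<close>, and \<open>N\<close> has to be an almost period itself for the cyclic
  wrap-around to do no harm; this costs a second factor \<open>C\<close>.\<close>

lemma almost_period_difference:
  assumes x: "x \<in> URec X nrm T" and e: "\<And>k. k \<in> {i, j, N} \<Longrightarrow> nrm ((T ^^ k) x - x) < e"
    and ij: "i < N" "j < N"
  shows "nrm ((T ^^ ((j + N - i) mod N)) x - x) \<le> 3 * C\<^sup>2 * e"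
proof -
  have xX: "x \<in> X" using x by (simp add: URec_def)
  let ?d = "\<lambda>p q. nrm ((T ^^ p) x - (T ^^ q) x)"
  have aX: "(T ^^ k) x \<in> X" for k using xX by (rule pow_mem)
  have e0: "e > 0" using e[of i] nrm_nonneg[of "(T ^^ i) x - x"] aX xX by (auto simp: diff_mem intro: le_less_trans)
  have CC: "C * (2 * e) \<le> 3 * C\<^sup>2 * e"
  proof -
    have "C * 1 \<le> C * C" using C_ge_1 by (intro mult_left_mono) auto
    then have "2 * C \<le> 3 * C\<^sup>2" using C_ge_1 unfolding power2_eq_square by linarith
    then have "2 * C * e \<le> 3 * C\<^sup>2 * e" using e0 by (intro mult_right_mono) auto
    then show ?thesis by (simp only: mult_ac)
  qed
  have sym: "?d p q = ?d q p" for p q using aX by (intro nrm_commute)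
  have forward: "nrm ((T ^^ (b - a)) x - x) \<le> C * (2 * e)" if "a \<le> b" "a \<in> {i, j}" "b \<in> {i, j}" for a b
  proof -
    have "?d b a \<le> nrm ((T ^^ b) x - x) + nrm (x - (T ^^ a) x)"
      using aX xX by (intro nrm_diff_triangle)
    also have "\<dots> \<le> 2 * e"
      using e[of a] e[of b] that nrm_commute[OF aX xX, of a] by auto
    finally have "C * ?d (a + (b - a)) a \<le> C * (2 * e)"
      using C_ge_1 that by (intro mult_left_mono) auto
    then show ?thesis
      using orbit_difference_bounded_below[OF x, of "b - a" a] by linarith
  qed
  show ?thesis
  proof (cases "i \<le> j")
    case True
    then have "(j + N - i) mod N = j - i" using ij by (simp add: mod_if)
    then show ?thesis using forward[of i j] True CC by auto
  next
    case False
    let ?p = "N - (i - j)"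
    have p: "(j + N - i) mod N = ?p" using False ij by auto
    have "?d N (i - j) \<le> nrm ((T ^^ N) x - x) + nrm (x - (T ^^ (i - j)) x)"
      using aX xX by (intro nrm_diff_triangle)
    also have "\<dots> \<le> e + C * (2 * e)"
      using e[of N] forward[of j i] False nrm_commute[OF aX xX, of "i - j"] by auto
    also have "\<dots> \<le> 3 * C * e" using C_ge_1 e0 by (simp add: algebra_simps)
    finally have "C * ?d (i - j + ?p) (i - j) \<le> C * (3 * C * e)"
      using C_ge_1 ij by (intro mult_left_mono) auto
    then show ?thesis
      using orbit_difference_bounded_below[OF x, of ?p "i - j"] p by (simp add: power2_eq_square mult_ac)
  qed
qed

text \<open>\<open>G z\<close> is the squared modulus of the Fourier transform of the indicator function
  of \<open>B\<close>; its nonnegativity makes the plain sum in the second claim control the sum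
  of absolute values.\<close>

lemma fourier_autocorrelation:
  fixes G :: "complex \<Rightarrow> complex"
  assumes B: "B \<subseteq> {..<N}" and N: "N > 0"
    and G_eq: "\<And>z. G z = (\<Sum>j\<in>B. z ^ j) * (\<Sum>i\<in>B. cnj z ^ i)"
  shows "(\<Sum>z | z ^ N = 1. scl (G z) (fourier N x z)) = (\<Sum>j\<in>B. \<Sum>i\<in>B. (T ^^ ((j + N - i) mod N)) x)"
    and "(\<Sum>z | z ^ N = 1. G z) = of_nat (N * card B)"
proof -
  let ?R = "{z::complex. z ^ N = 1}"
  let ?a = "\<lambda>k. (T ^^ k) x"
  have lt: "i < N" if "i \<in> B" for i using B that by auto
  have finB: "finite B" using B finite_subset by blast
  have G: "G z = (\<Sum>j\<in>B. \<Sum>i\<in>B. z ^ j * cnj z ^ i)" for z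
    by (simp add: G_eq sum_product)
  have "(\<Sum>z\<in>?R. G z) = (\<Sum>j\<in>B. \<Sum>i\<in>B. \<Sum>z\<in>?R. z ^ j * cnj z ^ i)"
    unfolding G by (subst sum.swap) (intro sum.cong refl sum.swap)
  also have "\<dots> = (\<Sum>j\<in>B. \<Sum>i\<in>B. if j = i then of_nat N else 0)"
    using lt by (intro sum.cong refl roots_of_unity_orthogonal)
  also have "\<dots> = of_nat (N * card B)"
    using finB by (simp add: sum.delta)
  finally show "(\<Sum>z\<in>?R. G z) = of_nat (N * card B)" .
  have "(\<Sum>z\<in>?R. scl (G z) (fourier N x z))
      = (\<Sum>z\<in>?R. \<Sum>j\<in>B. \<Sum>i\<in>B. \<Sum>k<N. scl (z ^ j * cnj z ^ i * cnj z ^ k) (scl (1 / of_nat N) (?a k)))"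
  proof (intro sum.cong refl)
    fix z
    have "scl c (fourier N x z) = (\<Sum>k<N. scl (c * cnj z ^ k) (scl (1 / of_nat N) (?a k)))" for c
      unfolding fourier_def by (simp add: scale_sum_right mult_ac)
    then show "scl (G z) (fourier N x z)
        = (\<Sum>j\<in>B. \<Sum>i\<in>B. \<Sum>k<N. scl (z ^ j * cnj z ^ i * cnj z ^ k) (scl (1 / of_nat N) (?a k)))"
      unfolding G scale_sum_left by simp
  qed
  also have "\<dots> = (\<Sum>j\<in>B. \<Sum>i\<in>B. \<Sum>k<N. \<Sum>z\<in>?R. scl (z ^ j * cnj z ^ i * cnj z ^ k) (scl (1 / of_nat N) (?a k)))"
    by (subst sum.swap, intro sum.cong refl, subst sum.swap, intro sum.cong refl sum.swap)
  also have "\<dots> = (\<Sum>j\<in>B. \<Sum>i\<in>B. \<Sum>k<N. if k = (j + N - i) mod N then ?a k else 0)"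
  proof (intro sum.cong refl)
    fix j i k assume "j \<in> B" "i \<in> B" "k \<in> {..<N}"
    then show "(\<Sum>z\<in>?R. scl (z ^ j * cnj z ^ i * cnj z ^ k) (scl (1 / of_nat N) (?a k)))
        = (if k = (j + N - i) mod N then ?a k else 0)"
      unfolding scale_sum_left[symmetric] using lt N by (subst roots_of_unity_triple) auto
  qed
  also have "\<dots> = (\<Sum>j\<in>B. \<Sum>i\<in>B. ?a ((j + N - i) mod N))"
    using N by (simp add: sum.delta)
  finally show "(\<Sum>z\<in>?R. scl (G z) (fourier N x z)) = \<dots>" .
qed

text \<open>The vector \<open>w\<close> divided by \<open>card B ^ 2\<close> is the mean of the orbit
  points at differences of almost periods, hence within \<open>e / 3\<close> of
  \<open>x\<close>; the weights \<open>G z / card B ^ 2\<close> sum to \<open>N / card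
  B\<close>, which is at most \<open>2 q\<close> since the almost periods are syndetic, so
  approximating every Fourier coefficient within \<open>e / (6 q)\<close> costs another \<open>e
  / 3\<close>.\<close>

theorem URec_subset_closure_span: "URec X nrm T \<subseteq> nrm_closure X nrm (span E)"
proof
  fix x assume x: "x \<in> URec X nrm T"
  have xX: "x \<in> X" using x by (simp add: URec_def)
  have "\<exists>a\<in>span E. nrm (x - a) < e" if e: "e > 0" for e
  proof -
    define \<epsilon> where "\<epsilon> = e / (9 * C\<^sup>2)"
    have \<epsilon>: "\<epsilon> > 0" "3 * C\<^sup>2 * \<epsilon> = e / 3" using e C_ge_1 by (auto simp: \<epsilon>_def)
    let ?A = "{n. nrm ((T ^^ n) x - x) < \<epsilon>}"
    have synd: "syndetic ?A" by (rule URec_returns_syndetic[OF x \<epsilon>(1)])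
    then obtain q :: nat where q: "q \<ge> 1" "\<And>n. n \<ge> q \<Longrightarrow> n \<le> 2 * q * card (?A \<inter> {..<n})"
      using syndetic_card by blast
    define \<eta> where "\<eta> = e / (6 * real q)"
    have \<eta>: "\<eta> > 0" using e q by (simp add: \<eta>_def)
    obtain N0 where N0: "\<And>N z. N \<ge> N0 \<Longrightarrow> N > 0 \<Longrightarrow> cmod z = 1 \<Longrightarrow> \<exists>v\<in>span E. nrm (fourier N x z - v) < \<eta>"
      using fourier_near_span_E[OF x \<eta>] by blast
    obtain N where N: "N \<ge> q + N0" "N \<in> ?A"
      using synd unfolding syndetic_def by fastforce
    have Npos: "N > 0" using N q by simp
    define B where "B = ?A \<inter> {..<N}"
    have card: "N \<le> 2 * q * card B" unfolding B_def using q(2)[of N] N by simp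
    have c0: "card B > 0" using card Npos by (cases "card B") auto
    let ?R = "{z::complex. z ^ N = 1}"
    let ?u = "fourier N x"
    have uX: "?u z \<in> X" for z by (rule fourier_mem[OF xX])
    have "\<forall>z. \<exists>v. z \<in> ?R \<longrightarrow> v \<in> span E \<and> nrm (?u z - v) < \<eta>"
      using N0[of N] N Npos unimodular_if_root_of_unity by fastforce
    then obtain v where v: "\<And>z. z \<in> ?R \<Longrightarrow> v z \<in> span E \<and> nrm (?u z - v z) < \<eta>" by metis
    have vX: "v z \<in> X" if "z \<in> ?R" for z using v[OF that] span_E_subset by auto
    define G where "G z = (\<Sum>j\<in>B. z ^ j) * (\<Sum>i\<in>B. cnj z ^ i)" for z :: complex
    have G: "G z = of_real (cmod (G z))" for z
    proof -
      have "G z = of_real ((cmod (\<Sum>j\<in>B. z ^ j))\<^sup>2)"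
        unfolding complex_norm_square by (simp add: G_def cnj_sum)
      then show ?thesis by (metis norm_of_real abs_of_nonneg zero_le_power2)
    qed
    have BN: "B \<subseteq> {..<N}" by (auto simp: B_def)
    note corr = fourier_autocorrelation[OF BN Npos G_def]
    have sumG: "(\<Sum>z\<in>?R. cmod (G z)) = N * card B"
    proof -
      have "complex_of_real (\<Sum>z\<in>?R. cmod (G z)) = of_real (real (N * card B))"
        using corr(2) by (simp flip: G)
      then show ?thesis by (simp only: of_real_eq_iff of_nat_mult)
    qed
    let ?c = "1 / of_nat (card B) ^ 2 :: complex"
    define a where "a = scl ?c (\<Sum>z\<in>?R. scl (G z) (v z))"
    have "a \<in> span E"
      unfolding a_def using v by (intro span_scale span_sum) auto
    have X1: "(T ^^ k) x \<in> X" for k using xX by (rule pow_mem)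
    define w where "w = (\<Sum>z\<in>?R. scl (G z) (?u z))"
    have wX: "w \<in> X" unfolding w_def using uX by (intro sum_mem scale_mem)
    have x_eq: "x = scl ?c (\<Sum>j\<in>B. \<Sum>i\<in>B. x)"
    proof -
      have "(\<Sum>i\<in>B. x) = scl (of_nat (card B)) x" for x
        using sum_constant_scale by (metis scale_one scale_sum_left sum_constant mult_1_right)
      then show ?thesis using c0 by (simp add: power2_eq_square)
    qed
    have "x - scl ?c w = scl ?c (\<Sum>j\<in>B. \<Sum>i\<in>B. x - (T ^^ ((j + N - i) mod N)) x)"
      unfolding w_def corr(1) by (subst x_eq) (simp add: scale_right_diff_distrib sum_subtractf)
    also have "nrm \<dots> = (1 / real (card B) ^ 2) * nrm (\<Sum>j\<in>B. \<Sum>i\<in>B. x - (T ^^ ((j + N - i) mod N)) x)"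
      using xX X1 by (subst nrm_scale) (auto simp: norm_divide norm_power intro!: sum_mem diff_mem)
    also have "\<dots> \<le> (1 / real (card B) ^ 2) * (\<Sum>j\<in>B. \<Sum>i\<in>B. e / 3)"
    proof (intro mult_left_mono)
      have "nrm (\<Sum>j\<in>B. \<Sum>i\<in>B. x - (T ^^ ((j + N - i) mod N)) x)
          \<le> (\<Sum>j\<in>B. \<Sum>i\<in>B. nrm (x - (T ^^ ((j + N - i) mod N)) x))"
        using xX X1 by (intro order_trans[OF nrm_sum_le] sum_mono nrm_sum_le sum_mem diff_mem)
      also have "\<dots> \<le> (\<Sum>j\<in>B. \<Sum>i\<in>B. e / 3)"
      proof (intro sum_mono)
        fix j i assume "j \<in> B" "i \<in> B"
        then have "nrm ((T ^^ ((j + N - i) mod N)) x - x) \<le> 3 * C\<^sup>2 * \<epsilon>"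
          using N(2) by (intro almost_period_difference[OF x]) (auto simp: B_def)
        then show "nrm (x - (T ^^ ((j + N - i) mod N)) x) \<le> e / 3"
          using \<epsilon>(2) nrm_commute[OF xX X1] by simp
      qed
      finally show "nrm (\<Sum>j\<in>B. \<Sum>i\<in>B. x - (T ^^ ((j + N - i) mod N)) x) \<le> (\<Sum>j\<in>B. \<Sum>i\<in>B. e / 3)" .
    qed simp
    also have "\<dots> = e / 3" using c0 by (simp add: power2_eq_square)
    finally have 1: "nrm (x - scl ?c w) \<le> e / 3" .
    have "scl ?c w - a = scl ?c (\<Sum>z\<in>?R. scl (G z) (?u z - v z))"
      by (simp add: w_def a_def scale_right_diff_distrib sum_subtractf)
    also have "nrm \<dots> = (1 / real (card B) ^ 2) * nrm (\<Sum>z\<in>?R. scl (G z) (?u z - v z))"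
      using uX vX by (subst nrm_scale) (auto simp: norm_divide norm_power intro!: sum_mem diff_mem scale_mem)
    also have "\<dots> \<le> (1 / real (card B) ^ 2) * (\<Sum>z\<in>?R. cmod (G z) * \<eta>)"
    proof (intro mult_left_mono)
      have "nrm (\<Sum>z\<in>?R. scl (G z) (?u z - v z)) \<le> (\<Sum>z\<in>?R. nrm (scl (G z) (?u z - v z)))"
        using uX vX by (intro nrm_sum_le scale_mem diff_mem)
      also have "\<dots> \<le> (\<Sum>z\<in>?R. cmod (G z) * \<eta>)"
      proof (rule sum_mono)
        fix z assume z: "z \<in> ?R"
        show "nrm (scl (G z) (?u z - v z)) \<le> cmod (G z) * \<eta>"
          unfolding nrm_scale[OF diff_mem[OF uX vX[OF z]]] using v[OF z] by (intro mult_left_mono) auto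
      qed
      finally show "nrm (\<Sum>z\<in>?R. scl (G z) (?u z - v z)) \<le> (\<Sum>z\<in>?R. cmod (G z) * \<eta>)" .
    qed simp
    also have "\<dots> = real N / real (card B) * \<eta>"
      unfolding sum_distrib_right[symmetric] sumG using c0 by (simp add: power2_eq_square)
    also have "\<dots> \<le> (2 * real q) * \<eta>"
    proof (intro mult_right_mono)
      have "real N \<le> 2 * real q * real (card B)"
        using card by (metis of_nat_le_iff of_nat_mult of_nat_numeral)
      then show "real N / real (card B) \<le> 2 * real q" using c0 by (simp add: field_simps)
    qed (use \<eta> in simp)
    also have "\<dots> = e / 3" using q by (simp add: \<eta>_def)
    finally have 2: "nrm (scl ?c w - a) \<le> e / 3" .
    have "a \<in> X" using \<open>a \<in> span E\<close> span_E_subset by auto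
    then have "nrm (x - a) \<le> e / 3 + e / 3"
      using nrm_diff_triangle[OF xX scale_mem[OF wX], of a ?c] 1 2 by linarith
    also have "\<dots> < e" using e by simp
    finally show ?thesis using \<open>a \<in> span E\<close> by blast
  qed
  then show "x \<in> nrm_closure X nrm (span E)"
    using xX by (simp add: mem_nrm_closure_iff[OF span_E_subset])
qed

end

section \<open>Direct sums\<close>

lemma restrict_image_tuples: "(\<lambda>x. restrict x I) ` tuples I A = Pi\<^sub>E I A"
proof (intro equalityI subsetI)
  fix x assume "x \<in> Pi\<^sub>E I A"
  then show "x \<in> (\<lambda>x. restrict x I) ` tuples I A"
    by (intro image_eqI[of _ _ "\<lambda>i. if i \<in> I then x i else 0"])
      (auto simp: tuples_def fun_eq_iff PiE_iff extensional_def)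
qed (auto simp: tuples_def)

lemma tuples_mono: "(\<And>i. i \<in> I \<Longrightarrow> A i \<subseteq> B i) \<Longrightarrow> tuples I A \<subseteq> tuples I B"
  by (auto simp: tuples_def)

text \<open>The norm \<open>p\<close> enters only through its topology, which restriction to
  \<open>I\<close> identifies with the product topology.\<close>

lemma direct_sum_closure:
  assumes ds: "direct_sum_norm scl I X nrm p"
    and X: "\<And>i. i \<in> I \<Longrightarrow> complex_normed_space scl (X i) (nrm i)"
    and A: "\<And>i. i \<in> I \<Longrightarrow> A i \<subseteq> X i"
  shows "nrm_closure (tuples I X) p (tuples I A) = tuples I (\<lambda>i. nrm_closure (X i) (nrm i) (A i))"
proof -
  let ?f = "\<lambda>x. restrict x I"
  let ?H = "nrm_topology (tuples I X) p" and ?P = "product_topology (\<lambda>i. nrm_topology (X i) (nrm i)) I"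
  let ?C = "\<lambda>i. nrm_closure (X i) (nrm i) (A i)"
  interpret H: complex_normed_space "fun_scale scl" "tuples I X" p
    using ds by (simp add: direct_sum_norm_def)
  have hom: "homeomorphic_map ?H ?P ?f" using ds by (simp add: direct_sum_norm_def)
  have "?f ` (?H closure_of tuples I A) = ?P closure_of (?f ` tuples I A)"
    using homeomorphic_map_closure_of[OF hom, of "tuples I A"] tuples_mono[of I A X] A by simp
  also have "\<dots> = ?f ` tuples I ?C"
    by (simp add: restrict_image_tuples closure_of_product_topology nrm_closure_def)
  finally have "?f ` nrm_closure (tuples I X) p (tuples I A) = ?f ` tuples I ?C"
    by (simp add: nrm_closure_def)
  moreover have "inj_on ?f (tuples I X)"
    using homeomorphic_imp_injective_map[OF hom] by simp
  moreover have "tuples I ?C \<subseteq> tuples I X"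
    using complex_normed_space.nrm_closure_subset[OF X] by (intro tuples_mono) auto
  ultimately show ?thesis
    using H.nrm_closure_subset by (simp add: inj_on_image_eq_iff)
qed

lemma tuples_eq_iff:
  assumes "\<And>i. i \<in> I \<Longrightarrow> C i \<subseteq> X i" "\<And>i. i \<in> I \<Longrightarrow> 0 \<in> C i"
  shows "tuples I C = tuples I X \<longleftrightarrow> (\<forall>i\<in>I. C i = X i)"
proof
  assume eq: "tuples I C = tuples I X"
  show "\<forall>i\<in>I. C i = X i"
  proof (intro ballI equalityI subsetI)
    fix i v assume i: "i \<in> I" and v: "v \<in> X i"
    have "(\<lambda>j. if j = i then v else 0) \<in> tuples I X"
      using i v assms by (auto simp: tuples_def)
    then have "(\<lambda>j. if j = i then v else 0) \<in> tuples I C" by (simp add: eq)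
    then show "v \<in> C i" using i by (fastforce simp: tuples_def)
  qed (use assms in auto)
qed (auto simp: tuples_def)

text \<open>A tuple is the sum of the tuples \<open>single i\<close> that have one nonzero entry, and
  those embed the eigenvectors of each \<open>T i\<close>; in this way entries with different
  eigenvalues combine in the span.\<close>

lemma span_eigenvectors_direct_sum:
  fixes scl :: "complex \<Rightarrow> 'a::ab_group_add \<Rightarrow> 'a" and I :: "'i set"
  assumes I: "finite I" and vs: "vector_space scl"
    and op: "\<And>i. i \<in> I \<Longrightarrow> operator_on_space scl (X i) (nrm i) (T i)"
  shows "module.span (fun_scale scl)
      (unimodular_eigenvectors (fun_scale scl) (tuples I X) (sum_operator I T))
    = tuples I (\<lambda>i. module.span scl (unimodular_eigenvectors scl (X i) (T i)))"
proof -
  interpret V: vector_space scl by (rule vs)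
  interpret F: vector_space "fun_scale scl" by (rule vector_space_fun_scale[OF vs])
  let ?E = "unimodular_eigenvectors (fun_scale scl) (tuples I X) (sum_operator I T)"
  let ?Ei = "\<lambda>i. unimodular_eigenvectors scl (X i) (T i)"
  let ?S = "tuples I (\<lambda>i. V.span (?Ei i))"
  have "F.subspace ?S"
    unfolding F.subspace_def tuples_def
    by (auto simp: fun_scale_def V.span_zero V.span_add V.span_scale)
  moreover have "?E \<subseteq> ?S"
  proof
    fix x assume "x \<in> ?E"
    then obtain \<mu> where \<mu>: "cmod \<mu> = 1" and x: "x \<in> tuples I X"
      and "fun_scale scl \<mu> x - sum_operator I T x = 0"
      by (auto simp: unimodular_eigenvectors_def)
    then have "scl \<mu> (x i) - sum_operator I T x i = 0" for i
      by (auto simp: fun_scale_def fun_eq_iff)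
    then have "T i (x i) = scl \<mu> (x i)" if "i \<in> I" for i
      using that by (simp add: sum_operator_def)
    then have "x i \<in> V.span (?Ei i)" if "i \<in> I" for i
      using operator_on_space.eigenspace_subset_span[OF op[OF that] _ \<mu>] x that
      by (auto simp: tuples_def)
    with x show "x \<in> ?S" by (auto simp: tuples_def)
  qed
  ultimately have 1: "F.span ?E \<subseteq> ?S" by (intro F.span_minimal)
  define single where "single i v = (\<lambda>j. if j = i then v else 0)" for i :: 'i and v :: 'a
  have single: "single i v \<in> F.span ?E" if i: "i \<in> I" and v: "v \<in> V.span (?Ei i)" for i v
  proof -
    have "V.subspace {v. single i v \<in> F.span ?E}"
    proof (rule V.subspaceI)
      have "single i 0 = 0" by (auto simp: single_def)
      then show "0 \<in> {v. single i v \<in> F.span ?E}" by (simp add: F.span_zero)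
    next
      fix v w assume "v \<in> {v. single i v \<in> F.span ?E}" "w \<in> {v. single i v \<in> F.span ?E}"
      moreover have "single i (v + w) = single i v + single i w" by (auto simp: single_def)
      ultimately show "v + w \<in> {v. single i v \<in> F.span ?E}" by (simp add: F.span_add)
    next
      fix c v assume "v \<in> {v. single i v \<in> F.span ?E}"
      moreover have "single i (scl c v) = fun_scale scl c (single i v)"
        by (auto simp: single_def fun_scale_def)
      ultimately show "scl c v \<in> {v. single i v \<in> F.span ?E}" by (simp add: F.span_scale)
    qed
    moreover have "?Ei i \<subseteq> {v. single i v \<in> F.span ?E}"
    proof
      fix v assume "v \<in> ?Ei i"
      then obtain \<mu> where \<mu>: "cmod \<mu> = 1" and v: "v \<in> X i" "v \<noteq> 0" "T i v = scl \<mu> v"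
        using operator_on_space.E_iff[OF op[OF i]] by blast
      have "single i v \<in> tuples I X"
        using i v complex_normed_space.zero_mem operator_on_space.axioms(1)[OF op]
        by (auto simp: tuples_def single_def)
      moreover have "fun_scale scl \<mu> (single i v) - sum_operator I T (single i v) = 0"
        using i v(3) operator_on_space.T_0[OF op]
        by (auto simp: fun_eq_iff fun_scale_def single_def sum_operator_def)
      moreover have "single i v \<noteq> 0"
        using v(2) by (auto simp: single_def fun_eq_iff)
      ultimately have "single i v \<in> ?E"
        using \<mu> unfolding unimodular_eigenvectors_def by blast
      then show "v \<in> {v. single i v \<in> F.span ?E}" by (auto intro: F.span_base)
    qed
    ultimately show ?thesis using V.span_minimal v by blast
  qed
  have "?S \<subseteq> F.span ?E"
  proof
    fix x assume x: "x \<in> ?S"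
    have "(\<lambda>j. if j \<in> J then x j else 0) \<in> F.span ?E" if "finite J" "J \<subseteq> I" for J
      using that
    proof (induction J rule: finite_induct)
      case empty
      then show ?case using F.span_zero by (simp add: zero_fun_def)
    next
      case (insert i J)
      have "(\<lambda>j. if j \<in> insert i J then x j else 0) = single i (x i) + (\<lambda>j. if j \<in> J then x j else 0)"
        using insert(2) by (auto simp: single_def fun_eq_iff)
      moreover have "single i (x i) \<in> F.span ?E"
        using insert x by (intro single) (auto simp: tuples_def)
      ultimately show ?case using insert by (simp add: F.span_add)
    qed
    from this[OF I order_refl] have "(\<lambda>j. if j \<in> I then x j else 0) \<in> F.span ?E" .
    moreover have "(\<lambda>j. if j \<in> I then x j else 0) = x"
      using x by (auto simp: tuples_def fun_eq_iff)
    ultimately show "x \<in> F.span ?E" by simp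
  qed
  with 1 show ?thesis by blast
qed

lemma direct_sum_eigenvector_closure:
  fixes scl :: "complex \<Rightarrow> 'a::ab_group_add \<Rightarrow> 'a"
  assumes I: "finite I" "I \<noteq> {}" and ds: "direct_sum_norm scl I X nrm p"
    and op: "\<And>i. i \<in> I \<Longrightarrow> operator_on_space scl (X i) (nrm i) (T i)"
    and R: "\<And>i. i \<in> I \<Longrightarrow> nrm_closure (X i) (nrm i)
        (module.span scl (unimodular_eigenvectors scl (X i) (T i))) = nrm_closure (X i) (nrm i) (R i)"
  defines "S \<equiv> module.span (fun_scale scl)
      (unimodular_eigenvectors (fun_scale scl) (tuples I X) (sum_operator I T))"
  shows "nrm_closure (tuples I X) p S = tuples I (\<lambda>i. nrm_closure (X i) (nrm i) (R i))
    \<and> (nrm_dense (tuples I X) p S \<longleftrightarrow> (\<forall>i\<in>I. nrm_dense (X i) (nrm i) (R i)))"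
proof -
  have X: "complex_normed_space scl (X i) (nrm i)" if "i \<in> I" for i
    using op[OF that] by (rule operator_on_space.axioms(1))
  then have vs: "vector_space scl"
    using I(2) complex_normed_space.axioms(1) by blast
  interpret V: vector_space scl by (rule vs)
  let ?S = "\<lambda>i. V.span (unimodular_eigenvectors scl (X i) (T i))"
  have SX: "?S i \<subseteq> X i" if "i \<in> I" for i
    using operator_on_space.span_E_subset[OF op[OF that]] .
  have "S = tuples I ?S"
    unfolding S_def by (rule span_eigenvectors_direct_sum[OF I(1) vs op])
  then have "nrm_closure (tuples I X) p S = nrm_closure (tuples I X) p (tuples I ?S)" by simp
  also have "\<dots> = tuples I (\<lambda>i. nrm_closure (X i) (nrm i) (?S i))"
    by (rule direct_sum_closure[OF ds X SX])
  also have "\<dots> = tuples I (\<lambda>i. nrm_closure (X i) (nrm i) (R i))"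
    using R by (auto simp: tuples_def)
  finally have eq: "nrm_closure (tuples I X) p S = tuples I (\<lambda>i. nrm_closure (X i) (nrm i) (R i))" .
  moreover have "tuples I (\<lambda>i. nrm_closure (X i) (nrm i) (R i)) = tuples I X
      \<longleftrightarrow> (\<forall>i\<in>I. nrm_closure (X i) (nrm i) (R i) = X i)"
  proof (rule tuples_eq_iff)
    fix i assume i: "i \<in> I"
    show "nrm_closure (X i) (nrm i) (R i) \<subseteq> X i"
      by (rule complex_normed_space.nrm_closure_subset[OF X[OF i]])
    have "0 \<in> ?S i" by (rule V.span_zero)
    then show "0 \<in> nrm_closure (X i) (nrm i) (R i)"
      using complex_normed_space.subset_nrm_closure[OF X[OF i] SX[OF i]] R[OF i] by auto
  qed
  ultimately show ?thesis by (simp add: nrm_dense_def)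
qed

section \<open>Closed spans of unimodular eigenvectors\<close>

lemma (in operator_on_hilbert_space) closure_span_eq_closure_RRec_bo:
  "nrm_closure X nrm (span E) = nrm_closure X nrm (RRec_bo X nrm T)"
  by (intro equalityI nrm_closure_mono nrm_closure_minimal
      span_E_subset_RRec_bo RRec_bo_subset_closure_span)

lemma (in power_bounded_on_banach_space) closure_span_eq_closure_URec:
  "nrm_closure X nrm (span E) = nrm_closure X nrm (URec X nrm T)"
  by (intro equalityI nrm_closure_mono nrm_closure_minimal
      span_E_subset_URec URec_subset_closure_span)

text \<open>The operator norm bounds the single quotients because each power of \<open>T\<close> is
  bounded; over an unbounded set of quotients the supremum would be an arbitrary real number.\<close>

lemma power_bounded_pow_bound:
  assumes X: "complex_normed_space scl X nrm" and pb: "power_bounded scl X nrm T"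
  obtains C where "C \<ge> 1" "\<And>x n. x \<in> X \<Longrightarrow> nrm ((T ^^ n) x) \<le> C * nrm x"
proof -
  interpret operator_on_space scl X nrm T
    using X pb by (auto simp: operator_on_space_def operator_on_space_axioms_def power_bounded_def)
  obtain K where K: "K > 0" "\<And>x. x \<in> X \<Longrightarrow> nrm (T x) \<le> K * nrm x" using T_bound by blast
  have pow: "nrm ((T ^^ n) x) \<le> K ^ n * nrm x" if "x \<in> X" for x n
  proof (induction n)
    case (Suc n)
    have "nrm (T ((T ^^ n) x)) \<le> K * nrm ((T ^^ n) x)" using that by (intro K pow_mem)
    also have "\<dots> \<le> K * (K ^ n * nrm x)" using Suc K(1) by simp
    finally show ?case by (simp add: mult.assoc)
  qed simp
  obtain M where M: "\<And>n. op_norm X nrm nrm (T ^^ n) \<le> M"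
    using pb by (auto simp: power_bounded_def bdd_above_def)
  have "nrm ((T ^^ n) x) \<le> max 1 M * nrm x" if x: "x \<in> X" for x n
  proof (cases "x = 0")
    case True
    have "(T ^^ n) 0 = 0" by (induction n) auto
    with True show ?thesis by simp
  next
    case False
    then have pos: "nrm x > 0" using x nrm_nonneg nrm_eq_0 by (metis order_le_less)
    have "bdd_above ((\<lambda>x. nrm ((T ^^ n) x) / nrm x) ` X)"
    proof (rule bdd_aboveI2)
      fix w assume w: "w \<in> X"
      show "nrm ((T ^^ n) w) / nrm w \<le> K ^ n"
        using pow[OF w, of n] nrm_nonneg[OF w] K(1) by (cases "nrm w = 0") (auto simp: field_simps)
    qed
    then have "nrm ((T ^^ n) x) / nrm x \<le> op_norm X nrm nrm (T ^^ n)"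
      unfolding op_norm_def using x by (intro cSUP_upper)
    also have "\<dots> \<le> max 1 M" using M[of n] by simp
    finally show ?thesis using pos by (simp add: field_simps)
  qed
  then show ?thesis by (intro that[of "max 1 M"]) auto
qed

theorem theorem5p8:
  fixes N :: nat
  assumes "N \<ge> 1"
  shows
   "(\<forall>(scl :: complex \<Rightarrow> 'a::ab_group_add \<Rightarrow> 'a) (H :: nat \<Rightarrow> 'a set) (nrm :: nat \<Rightarrow> 'a \<Rightarrow> real)
       (ip :: nat \<Rightarrow> 'a \<Rightarrow> 'a \<Rightarrow> complex) (T :: nat \<Rightarrow> 'a \<Rightarrow> 'a) (p :: (nat \<Rightarrow> 'a) \<Rightarrow> real).
       (\<forall>i\<in>{1..N}. complex_hilbert_space scl (H i) (nrm i) (ip i)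
                   \<and> bounded_operator scl (H i) (nrm i) (T i))
       \<and> direct_sum_norm scl {1..N} H nrm p
     \<longrightarrow>
       nrm_closure (tuples {1..N} H) p
         (module.span (fun_scale scl)
            (unimodular_eigenvectors (fun_scale scl) (tuples {1..N} H) (sum_operator {1..N} T)))
       = tuples {1..N} (\<lambda>i. nrm_closure (H i) (nrm i) (RRec_bo (H i) (nrm i) (T i)))
       \<and> (nrm_dense (tuples {1..N} H) p
            (module.span (fun_scale scl)
               (unimodular_eigenvectors (fun_scale scl) (tuples {1..N} H) (sum_operator {1..N} T)))
          \<longleftrightarrow> (\<forall>i\<in>{1..N}. nrm_dense (H i) (nrm i) (RRec_bo (H i) (nrm i) (T i)))))
    \<and>
    (\<forall>(scl :: complex \<Rightarrow> 'b::ab_group_add \<Rightarrow> 'b) (X :: nat \<Rightarrow> 'b set) (nrm :: nat \<Rightarrow> 'b \<Rightarrow> real)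
       (T :: nat \<Rightarrow> 'b \<Rightarrow> 'b) (p :: (nat \<Rightarrow> 'b) \<Rightarrow> real).
       (\<forall>i\<in>{1..N}. complex_banach_space scl (X i) (nrm i)
                   \<and> reflexive_space scl (X i) (nrm i)
                   \<and> power_bounded scl (X i) (nrm i) (T i))
       \<and> direct_sum_norm scl {1..N} X nrm p
     \<longrightarrow>
       nrm_closure (tuples {1..N} X) p
         (module.span (fun_scale scl)
            (unimodular_eigenvectors (fun_scale scl) (tuples {1..N} X) (sum_operator {1..N} T)))
       = tuples {1..N} (\<lambda>i. nrm_closure (X i) (nrm i) (URec (X i) (nrm i) (T i)))
       \<and> (nrm_dense (tuples {1..N} X) p
            (module.span (fun_scale scl)
               (unimodular_eigenvectors (fun_scale scl) (tuples {1..N} X) (sum_operator {1..N} T)))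
          \<longleftrightarrow> (\<forall>i\<in>{1..N}. nrm_dense (X i) (nrm i) (URec (X i) (nrm i) (T i)))))"
proof (intro conjI[of "All _" "All _"] allI impI)
  fix scl :: "complex \<Rightarrow> 'a \<Rightarrow> 'a" and H nrm ip T p
  assume asm: "(\<forall>i\<in>{1..N}. complex_hilbert_space scl (H i) (nrm i) (ip i)
      \<and> bounded_operator scl (H i) (nrm i) (T i)) \<and> direct_sum_norm scl {1..N} H nrm p"
  have op: "operator_on_hilbert_space scl (H i) (nrm i) (ip i) (T i)" if "i \<in> {1..N}" for i
    using asm that complex_hilbert_space.axioms(1) complex_banach_space.axioms(1)
    unfolding operator_on_hilbert_space_def operator_on_space_def operator_on_space_axioms_def by blast
  show "nrm_closure (tuples {1..N} H) p
         (module.span (fun_scale scl)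
            (unimodular_eigenvectors (fun_scale scl) (tuples {1..N} H) (sum_operator {1..N} T)))
       = tuples {1..N} (\<lambda>i. nrm_closure (H i) (nrm i) (RRec_bo (H i) (nrm i) (T i)))
       \<and> (nrm_dense (tuples {1..N} H) p
            (module.span (fun_scale scl)
               (unimodular_eigenvectors (fun_scale scl) (tuples {1..N} H) (sum_operator {1..N} T)))
          \<longleftrightarrow> (\<forall>i\<in>{1..N}. nrm_dense (H i) (nrm i) (RRec_bo (H i) (nrm i) (T i))))"
    using asm assms op
    by (intro direct_sum_eigenvector_closure operator_on_hilbert_space.closure_span_eq_closure_RRec_bo)
      (auto intro: operator_on_hilbert_space.axioms(2))
next
  fix scl :: "complex \<Rightarrow> 'b \<Rightarrow> 'b" and X nrm T p
  assume asm: "(\<forall>i\<in>{1..N}. complex_banach_space scl (X i) (nrm i)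
      \<and> reflexive_space scl (X i) (nrm i) \<and> power_bounded scl (X i) (nrm i) (T i))
      \<and> direct_sum_norm scl {1..N} X nrm p"
  have op: "\<exists>C. power_bounded_on_banach_space scl (X i) (nrm i) (T i) C" if i: "i \<in> {1..N}" for i
  proof -
    have B: "complex_banach_space scl (X i) (nrm i)" and P: "power_bounded scl (X i) (nrm i) (T i)"
      using asm i by auto
    note N = complex_banach_space.axioms(1)[OF B]
    obtain C where "C \<ge> 1" "\<And>x n. x \<in> X i \<Longrightarrow> nrm i ((T i ^^ n) x) \<le> C * nrm i x"
      using power_bounded_pow_bound[OF N P] by blast
    then show ?thesis
      using B N P unfolding power_bounded_on_banach_space_def power_bounded_on_banach_space_axioms_def
        operator_on_space_def operator_on_space_axioms_def power_bounded_def by blast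
  qed
  show "nrm_closure (tuples {1..N} X) p
         (module.span (fun_scale scl)
            (unimodular_eigenvectors (fun_scale scl) (tuples {1..N} X) (sum_operator {1..N} T)))
       = tuples {1..N} (\<lambda>i. nrm_closure (X i) (nrm i) (URec (X i) (nrm i) (T i)))
       \<and> (nrm_dense (tuples {1..N} X) p
            (module.span (fun_scale scl)
               (unimodular_eigenvectors (fun_scale scl) (tuples {1..N} X) (sum_operator {1..N} T)))
          \<longleftrightarrow> (\<forall>i\<in>{1..N}. nrm_dense (X i) (nrm i) (URec (X i) (nrm i) (T i))))"
  proof (rule direct_sum_eigenvector_closure)
    fix i assume "i \<in> {1..N}"
    then obtain C where C: "power_bounded_on_banach_space scl (X i) (nrm i) (T i) C" using op by blast
    show "operator_on_space scl (X i) (nrm i) (T i)"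
      using C by (rule power_bounded_on_banach_space.axioms(2))
    show "nrm_closure (X i) (nrm i) (module.span scl (unimodular_eigenvectors scl (X i) (T i)))
        = nrm_closure (X i) (nrm i) (URec (X i) (nrm i) (T i))"
      by (rule power_bounded_on_banach_space.closure_span_eq_closure_URec[OF C])
  qed (use asm assms in auto)
qed

end
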